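(* For any two continua $K^-$ and $K^+$ of the Riemann sphere $\overline{\mathbb C}$, there exists an analytic curve $\gamma:(-\infty,+\infty)\to\mathbb C$, which is the restriction to the real line of an entire function, such that $$C(\gamma,-\infty)=K^-\quad\text{and}\quad C(\gamma,+\infty)=K^+.$$ Moreover, the curve $\gamma$ is maximal as an analytic curve.
   Context: $\overline{\mathbb C}=\mathbb C\cup\{\infty\}$ is the Riemann sphere. A continuum in $\overline{\mathbb C}$ is a nonempty compact connected subset (a single point is allowed). Analytic curves: for $-\infty\le a<b\le+\infty$, a map $\gamma:(a,b)\to\overline{\mathbb C}$ is a real-analytic curve if for every $t_0\in(a,b)$ and every local holomorphic coordinate $z$ of $\overline{\mathbb C}$ at $\gamma(t_0)$, the function $z\circ\gamma$ is represented by a power series in an interval centered at $t_0$ (equivalently: $\gamma$ has a power series development about each $t_0$ with $\gamma(t_0)$ finite, and $1/\gamma$ has one about each $t_0$ with $\gamma(t_0)=\infty$). It is regular if $(z\circ\gamma)'$ has no zeros for every local coordinate $z$. "Analytic curve" means regular real-analytic curve. Cluster sets: for a curve $\gamma:(a,b)\to\overline{\mathbb C}$ and $e\in\{a,b\}$, $$C(\gamma,e)=\{w\in\overline{\mathbb C}:\ \exists\, t_n\in(a,b),\ t_n\to e,\ \gamma(t_n)\to w\}.$$ Extensions and maximality: an analytic curve $\gamma(t)$, $a<t<b$, can be extended initially if there are an analytic curve $\sigma:(L,R)\to\overline{\mathbb C}$, a value $A\in(L,R)$, and an analytic change of parameter $t:(A,R)\to(a,b)$ (an increasing real-analytic bijection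 with nowhere vanishing derivative) such that $\sigma(s)=\gamma(t(s))$ for $A<s<R$. A terminal analytic extension is defined analogously: $A\in(L,R)$, an analytic change of parameter $t:(L,A)\to(a,b)$, and $\sigma(s)=\gamma(t(s))$ for $L<s<A$. An analytic curve is maximal as an analytic curve if it has neither an initial nor a terminal analytic extension. *)

theory Defs
  imports "HOL-Complex_Analysis.Complex_Analysis"
begin

text \<open>
  The Riemann sphere is the one-point compactification of the complex plane: the finite point
  \<open>w\<close> is \<open>Some w\<close>, and the point at infinity is \<open>None\<close>.
\<close>

abbreviation riemann_sphere :: "complex option topology" where
  "riemann_sphere \<equiv> Alexandroff_compactification euclidean"

definition continuum_in :: "'a topology \<Rightarrow> 'a set \<Rightarrow> bool" where
  "continuum_in X K \<longleftrightarrow> K \<noteq> {} \<and> compactin X K \<and> connectedin X K"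

text \<open>
  The complex structure of the sphere is given by the two standard parametrisations \<open>Some\<close> and
  \<open>at_infinity_param\<close>, the latter covering everything except the origin. The function
  \<open>inverse\<close> is their transition map.
\<close>

definition at_infinity_param :: "complex \<Rightarrow> complex option" where
  "at_infinity_param w = (if w = 0 then None else Some (inverse w))"

definition sphere_holomorphic_on :: "(complex option \<Rightarrow> complex) \<Rightarrow> complex option set \<Rightarrow> bool" where
  "sphere_holomorphic_on z U \<longleftrightarrow>
     (z \<circ> Some) holomorphic_on (Some -` U) \<and>
     (z \<circ> at_infinity_param) holomorphic_on (at_infinity_param -` U)"

definition local_coordinate :: "complex option set \<Rightarrow> (complex option \<Rightarrow> complex) \<Rightarrow> bool" where
  "local_coordinate U z \<longleftrightarrow> openin riemann_sphere U \<and> sphere_holomorphic_on z U \<and> inj_on z U"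

definition power_series_near :: "(real \<Rightarrow> 'a::real_normed_vector) \<Rightarrow> real \<Rightarrow> real \<Rightarrow> bool" where
  "power_series_near f t0 r \<longleftrightarrow>
     (\<exists>c. \<forall>t. \<bar>t - t0\<bar> < r \<longrightarrow> (\<lambda>n. (t - t0) ^ n *\<^sub>R c n) sums f t)"

text \<open>
  Parameter intervals are \<open>einterval a b\<close> with extended real end points. Curves are total
  functions on the reals whose values outside the parameter interval are irrelevant.
\<close>

definition real_analytic_curve :: "ereal \<Rightarrow> ereal \<Rightarrow> (real \<Rightarrow> complex option) \<Rightarrow> bool" where
  "real_analytic_curve a b \<gamma> \<longleftrightarrow> a < b \<and>
     (\<forall>t0\<in>einterval a b. \<forall>U z. local_coordinate U z \<and> \<gamma> t0 \<in> U \<longrightarrow>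
        (\<exists>r>0. (\<forall>t. \<bar>t - t0\<bar> < r \<longrightarrow> t \<in> einterval a b \<and> \<gamma> t \<in> U) \<and>
               power_series_near (z \<circ> \<gamma>) t0 r))"

definition regular_curve :: "ereal \<Rightarrow> ereal \<Rightarrow> (real \<Rightarrow> complex option) \<Rightarrow> bool" where
  "regular_curve a b \<gamma> \<longleftrightarrow>
     (\<forall>U z. local_coordinate U z \<longrightarrow>
        (\<forall>t\<in>einterval a b. \<gamma> t \<in> U \<longrightarrow> vector_derivative (z \<circ> \<gamma>) (at t) \<noteq> 0))"

definition analytic_curve :: "ereal \<Rightarrow> ereal \<Rightarrow> (real \<Rightarrow> complex option) \<Rightarrow> bool" where
  "analytic_curve a b \<gamma> \<longleftrightarrow> real_analytic_curve a b \<gamma> \<and> regular_curve a b \<gamma>"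

definition cluster_set :: "ereal \<Rightarrow> ereal \<Rightarrow> (real \<Rightarrow> complex option) \<Rightarrow> ereal \<Rightarrow> complex option set" where
  "cluster_set a b \<gamma> e =
     {w. \<exists>t :: nat \<Rightarrow> real. (\<forall>n. t n \<in> einterval a b) \<and> (\<lambda>n. ereal (t n)) \<longlonglongrightarrow> e \<and>
           limitin riemann_sphere (\<lambda>n. \<gamma> (t n)) w sequentially}"

definition analytic_param_change ::
    "ereal \<Rightarrow> ereal \<Rightarrow> ereal \<Rightarrow> ereal \<Rightarrow> (real \<Rightarrow> real) \<Rightarrow> bool" where
  "analytic_param_change c d a b \<phi> \<longleftrightarrow>
     bij_betw \<phi> (einterval c d) (einterval a b) \<and>
     strict_mono_on (einterval c d) \<phi> \<and>
     (\<forall>s\<in>einterval c d.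
        (\<exists>r>0. (\<forall>t. \<bar>t - s\<bar> < r \<longrightarrow> t \<in> einterval c d) \<and> power_series_near \<phi> s r) \<and>
        deriv \<phi> s \<noteq> 0)"

definition has_initial_extension :: "ereal \<Rightarrow> ereal \<Rightarrow> (real \<Rightarrow> complex option) \<Rightarrow> bool" where
  "has_initial_extension a b \<gamma> \<longleftrightarrow>
     (\<exists>L R \<sigma> A \<phi>. analytic_curve L R \<sigma> \<and> A \<in> einterval L R \<and>
        analytic_param_change (ereal A) R a b \<phi> \<and>
        (\<forall>s\<in>einterval (ereal A) R. \<sigma> s = \<gamma> (\<phi> s)))"

definition has_terminal_extension :: "ereal \<Rightarrow> ereal \<Rightarrow> (real \<Rightarrow> complex option) \<Rightarrow> bool" where
  "has_terminal_extension a b \<gamma> \<longleftrightarrow>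
     (\<exists>L R \<sigma> A \<phi>. analytic_curve L R \<sigma> \<and> A \<in> einterval L R \<and>
        analytic_param_change L (ereal A) a b \<phi> \<and>
        (\<forall>s\<in>einterval L (ereal A). \<sigma> s = \<gamma> (\<phi> s)))"

definition maximal_analytic_curve :: "ereal \<Rightarrow> ereal \<Rightarrow> (real \<Rightarrow> complex option) \<Rightarrow> bool" where
  "maximal_analytic_curve a b \<gamma> \<longleftrightarrow>
     analytic_curve a b \<gamma> \<and> \<not> has_initial_extension a b \<gamma> \<and> \<not> has_terminal_extension a b \<gamma>"

end

theory Submission
  imports Defs "HOL-Real_Asymp.Real_Asymp"
begin

text \<open>
  The curve is built explicitly; no approximation theorem for entire functions enters. The
  observation behind it is that a continuum can be explored at an arbitrarily slow speed, and
  that slow motions are easily imitated by entire functions.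

  A continuum \<open>K\<close> is first replaced by a sequence \<open>w\<close> of complex numbers whose successive
  differences tend to \<open>0\<close> and whose limit points on the sphere form exactly \<open>K\<close>
  (\<open>continuum_is_cluster_set_of_slow_sequence\<close>). Connectedness supplies the small steps: any two
  points are joined by chains of arbitrarily short steps inside \<open>K\<close>, provided that, when
  \<open>\<infinity> \<in> K\<close>, the chains may also use finite points very close to \<open>\<infinity>\<close>.

  Such a sequence is then played back on a logarithmic time scale. The entire function
  \<open>P(z) = w\<^sub>0 + \<Sum>\<^sub>n (w\<^sub>n\<^sub>+\<^sub>1 - w\<^sub>n) (1 - exp (-(z / 2\<^sup>n)\<^sup>2))\<close> has the property that its \<open>n\<close>-th
  summand is switched on, along the real line, when \<open>\<bar>t\<bar>\<close> passes \<open>2\<^sup>n\<close>. At time \<open>t\<close> only the steps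
  with \<open>n\<close> near \<open>log\<^sub>2 \<bar>t\<bar>\<close> are in transition, and those steps are short, so \<open>P(t)\<close> is
  asymptotic to \<open>w\<^sub>m\<close> with \<open>m = \<lfloor>log\<^sub>2 \<bar>t\<bar>\<rfloor>\<close> (\<open>log_interpolant_asymptotic\<close>). Two such functions, one
  for each end, are combined with the entire switch \<open>exp (- exp (- z))\<close>, which tends to \<open>1\<close> at
  \<open>+\<infinity>\<close> and to \<open>0\<close> at \<open>-\<infinity>\<close> so fast that the linear growth of the interpolants does no harm.
  The result \<open>D\<close> is entire, its cluster sets are correct, and \<open>D'\<close> grows at most linearly on the
  real line.

  Finally \<open>D\<close> is decorated with loops that become tiny and ever faster:
  \<open>f(z) = D(z) + exp (-z\<^sup>2 + i \<lambda> z exp (z\<^sup>2))\<close>. On the real line the loops tend to \<open>0\<close>, hence leave the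
  cluster sets alone, but their speed is at least \<open>\<lambda> (1 + 2t\<^sup>2)\<close>, which beats \<open>D'\<close>. This serves two
  purposes. It makes \<open>f'\<close> free of real zeros, so that the curve is regular; and it makes the
  direction of \<open>f'\<close> turn around infinitely often near both ends while \<open>f\<close> hardly moves
  (\<open>looped_reversing_sequences\<close>). A curve with an analytic extension has a limiting tangent
  direction at the end in a suitable coordinate of the sphere, which is incompatible with these
  reversals (\<open>tangent_directions_agree\<close>). The argument for maximality is therefore the same
  whether or not a continuum is a single point.
\<close>

section \<open>Convergence on the Riemann sphere\<close>

lemma openin_riemann_sphere_None:
  assumes "compact C"
  shows "openin riemann_sphere (insert None (Some ` (- C)))"
  unfolding openin_Alexandroff_compactification
  using assms compact_imp_closed by (auto simp: Compl_eq_Diff_UNIV)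

lemma openin_riemann_sphere_cases:
  assumes "openin riemann_sphere U"
  obtains S where "open S" "U = Some ` S" | C where "compact C" "U = insert None (Some ` (- C))"
  using assms by (auto simp: openin_Alexandroff_compactification Compl_eq_Diff_UNIV)

lemma open_vimage_Some_riemann_sphere:
  assumes "openin riemann_sphere U"
  shows "open (Some -` U)"
  using assms
proof (cases rule: openin_riemann_sphere_cases)
  case (1 S)
  then show ?thesis by (simp add: inj_vimage_image_eq)
next
  case (2 C)
  then have "Some -` U = - C" by auto
  with 2 show ?thesis by (simp add: compact_imp_closed open_Compl)
qed

lemma limitin_riemann_sphere_Some:
  "limitin riemann_sphere (\<lambda>n. Some (f n)) (Some z) F \<longleftrightarrow> (f \<longlongrightarrow> z) F"
proof
  assume L: "limitin riemann_sphere (\<lambda>n. Some (f n)) (Some z) F"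
  show "(f \<longlongrightarrow> z) F"
  proof (rule topological_tendstoI)
    fix S :: "complex set" assume "open S" "z \<in> S"
    then have "openin riemann_sphere (Some ` S)"
      by (auto simp: openin_Alexandroff_compactification)
    with L \<open>z \<in> S\<close> have "\<forall>\<^sub>F x in F. Some (f x) \<in> Some ` S"
      unfolding limitin_def by blast
    then show "\<forall>\<^sub>F x in F. f x \<in> S" by (auto elim: eventually_mono)
  qed
next
  assume T: "(f \<longlongrightarrow> z) F"
  show "limitin riemann_sphere (\<lambda>n. Some (f n)) (Some z) F"
    unfolding limitin_def
  proof (intro conjI allI impI)
    fix U assume U: "openin riemann_sphere U \<and> Some z \<in> U"
    then have "open (Some -` U)" by (simp add: open_vimage_Some_riemann_sphere)
    with T U have "\<forall>\<^sub>F x in F. f x \<in> Some -` U"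
      by (intro topological_tendstoD) auto
    then show "\<forall>\<^sub>F x in F. Some (f x) \<in> U" by simp
  qed auto
qed

lemma limitin_riemann_sphere_None:
  "limitin riemann_sphere (\<lambda>n. Some (f n)) None F \<longleftrightarrow> filterlim f at_infinity F"
proof
  assume L: "limitin riemann_sphere (\<lambda>n. Some (f n)) None F"
  have "\<forall>\<^sub>F x in F. r \<le> norm (f x)" for r
  proof -
    have "\<forall>\<^sub>F x in F. Some (f x) \<in> insert None (Some ` (- cball 0 r))"
      using L openin_riemann_sphere_None[OF compact_cball] unfolding limitin_def by blast
    then show ?thesis by (auto elim: eventually_mono)
  qed
  then show "filterlim f at_infinity F"
    by (subst filterlim_at_infinity[where c = 0]) auto
next
  assume T: "filterlim f at_infinity F"
  show "limitin riemann_sphere (\<lambda>n. Some (f n)) None F"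
    unfolding limitin_def
  proof (intro conjI allI impI)
    fix U assume U: "openin riemann_sphere U \<and> None \<in> U"
    then obtain C where C: "compact C" "U = insert None (Some ` (- C))"
      by (metis imageE openin_riemann_sphere_cases option.distinct(1))
    then obtain b where b: "\<And>x. x \<in> C \<Longrightarrow> norm x \<le> b"
      by (meson bounded_iff compact_imp_bounded)
    have "\<forall>\<^sub>F x in F. \<bar>b\<bar> + 1 \<le> norm (f x)"
      using T unfolding filterlim_at_infinity[OF order_refl] by (metis abs_ge_zero add_nonneg_pos zero_less_one)
    then show "\<forall>\<^sub>F x in F. Some (f x) \<in> U"
      by (rule eventually_mono) (use b C in force)
  qed auto
qed

text \<open>
  Both conditions for convergence on the sphere only see the sequence up to a null sequence.
\<close>

lemma limitin_riemann_sphere_perturb: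
  assumes "((\<lambda>n. f n - g n) \<longlongrightarrow> 0) F"
    and "limitin riemann_sphere (\<lambda>n. Some (g n)) v F"
  shows "limitin riemann_sphere (\<lambda>n. Some (f n)) v F"
proof (cases v)
  case None
  then have "filterlim g at_infinity F"
    using assms(2) by (simp add: limitin_riemann_sphere_None)
  from tendsto_add_filterlim_at_infinity[OF assms(1) this]
  show ?thesis unfolding None limitin_riemann_sphere_None by simp
next
  case (Some z)
  then have "(g \<longlongrightarrow> z) F"
    using assms(2) by (simp add: limitin_riemann_sphere_Some)
  from tendsto_add[OF assms(1) this]
  show ?thesis unfolding Some limitin_riemann_sphere_Some by simp
qed

lemma closedin_riemann_sphere:
  "continuum_in riemann_sphere K \<Longrightarrow> closedin riemann_sphere K"
  unfolding continuum_in_def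
  by (metis Hausdorff_space_Alexandroff_compactification Hausdorff_space_euclidean compactin_imp_closedin locally_compact_space_euclidean)

section \<open>A continuum as the set of limit points of a slow sequence\<close>

text \<open>
  A curve in the plane may have to pass near \<open>\<infinity>\<close> in order to get from one part of \<open>K\<close> to another,
  for instance when \<open>K\<close> consists of two parallel lines and \<open>\<infinity>\<close>. If \<open>\<infinity> \<in> K\<close>, the planar set that
  stands in for \<open>K\<close> therefore contains a whole punctured neighbourhood of \<open>\<infinity>\<close>; it shrinks to
  the finite part of \<open>K\<close> as \<open>R \<rightarrow> \<infinity>\<close>.
\<close>

definition enlarged_finite_part :: "complex option set \<Rightarrow> real \<Rightarrow> complex set" where
  "enlarged_finite_part K R = {z. Some z \<in> K \<or> None \<in> K \<and> R \<le> norm z}"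

definition chain_step :: "'a::metric_space set \<Rightarrow> real \<Rightarrow> 'a \<Rightarrow> 'a \<Rightarrow> bool" where
  "chain_step E e x y \<longleftrightarrow> x \<in> E \<and> y \<in> E \<and> dist x y < e"

text \<open>
  A decomposition of the planar set at positive distance separates \<open>K\<close> on the sphere:
  \<open>\<infinity>\<close> goes with the part \<open>X\<close>, which contains all finite points near it.
\<close>

lemma enlarged_finite_part_not_separated:
  assumes K: "continuum_in riemann_sphere K"
    and E: "enlarged_finite_part K R = X \<union> Y" and ne: "X \<noteq> {}" "Y \<noteq> {}"
    and sep: "\<And>x y. x \<in> X \<Longrightarrow> y \<in> Y \<Longrightarrow> e \<le> dist x y" and "e > 0"
    and far: "\<And>z. None \<in> K \<Longrightarrow> R \<le> norm z \<Longrightarrow> z \<in> X"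
  shows False
proof -
  define U where "U = (\<Union>x\<in>X. ball x e)"
  define V where "V = (\<Union>y\<in>Y. ball y e)"
  have UV: "open U" "open V" "X \<subseteq> U" "Y \<subseteq> V" "U \<inter> Y = {}" "V \<inter> X = {}"
    unfolding U_def V_def using sep \<open>e > 0\<close> by (force simp: dist_commute)+
  define P where "P = (if None \<in> K then insert None (Some ` (- (cball 0 R - U))) else Some ` U)"
  have "compact (cball 0 R - U)"
    using UV by (simp add: compact_diff)
  then have P: "openin riemann_sphere P"
    unfolding P_def using UV(1) openin_riemann_sphere_None[of "cball 0 R - U"] by auto
  have Q: "openin riemann_sphere (Some ` V)"
    using UV(2) by simp
  have in_E: "Some z \<in> K \<Longrightarrow> z \<in> X \<union> Y" for z
    unfolding E[symmetric] enlarged_finite_part_def by simp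
  have in_K: "z \<in> X \<union> Y \<Longrightarrow> Some z \<in> K \<or> None \<in> K \<and> z \<in> X" for z
    unfolding E[symmetric] enlarged_finite_part_def using far by auto
  have cover: "K \<subseteq> P \<union> Some ` V"
  proof
    fix v assume v: "v \<in> K"
    show "v \<in> P \<union> Some ` V"
    proof (cases v)
      case (Some z)
      with v in_E UV(3,4) have "z \<in> U \<or> z \<in> V" by blast
      then show ?thesis unfolding P_def Some by auto
    qed (use v in \<open>auto simp: P_def\<close>)
  qed
  have disj: "P \<inter> Some ` V \<inter> K = {}"
  proof -
    have False if "Some z \<in> P" "z \<in> V" "Some z \<in> K" for z
    proof -
      have "z \<in> Y" using in_E[OF that(3)] that(2) UV(6) by blast
      moreover from this UV(5) have "z \<notin> U" by blast
      ultimately have "None \<in> K" "R \<le> norm z" using that(1) by (auto simp: P_def split: if_splits)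
      with far \<open>z \<in> V\<close> UV(6) show False by blast
    qed
    then show ?thesis by blast
  qed
  have meetP: "P \<inter> K \<noteq> {}"
  proof (cases "None \<in> K")
    case False
    obtain x where "x \<in> X" using ne by blast
    with False in_K UV(3) have "Some x \<in> P \<inter> K" unfolding P_def by auto
    then show ?thesis by blast
  qed (auto simp: P_def)
  obtain y where y: "y \<in> Y" using ne by blast
  then have "y \<notin> X" using UV(4,6) by blast
  with y in_K UV(4) have "Some y \<in> Some ` V \<inter> K" by blast
  then show False
    using K cover disj meetP P Q unfolding continuum_in_def connectedin by blast
qed

text \<open>
  The points reachable from \<open>a\<close> have distance at least \<open>e\<close> from all others. The part near
  \<open>\<infinity>\<close> is itself connected, so it lies on one side, and the preceding lemma applies to the
  decomposition in one of its two orders.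
\<close>

lemma enlarged_finite_part_chain_connected:
  assumes K: "continuum_in riemann_sphere K" and "e > 0"
    and a: "a \<in> enlarged_finite_part K R" and b: "b \<in> enlarged_finite_part K R"
  shows "(chain_step (enlarged_finite_part K R) e)\<^sup>*\<^sup>* a b"
proof (rule ccontr)
  let ?E = "enlarged_finite_part K R"
  let ?r = "chain_step ?E e"
  define A where "A = {z \<in> ?E. ?r\<^sup>*\<^sup>* a z}"
  define B where "B = ?E - A"
  assume "\<not> ?r\<^sup>*\<^sup>* a b"
  then have ne: "A \<noteq> {}" "B \<noteq> {}" using a b unfolding A_def B_def by auto
  have E: "?E = A \<union> B" "?E = B \<union> A" unfolding A_def B_def by auto
  have sep: "e \<le> dist x y" if "x \<in> A" "y \<in> B" for x y
  proof (rule ccontr)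
    assume "\<not> e \<le> dist x y"
    with that have "?r x y" unfolding A_def B_def chain_step_def by auto
    with that show False unfolding A_def B_def by (auto dest: rtranclp.rtrancl_into_rtrancl)
  qed
  have sep': "e \<le> dist y x" if "x \<in> A" "y \<in> B" for x y
    using sep[OF that] by (simp add: dist_commute)
  define U where "U = (\<Union>x\<in>A. ball x e)"
  define V where "V = (\<Union>x\<in>B. ball x e)"
  have UV: "open U" "open V" "A \<subseteq> U" "B \<subseteq> V" "U \<inter> B = {}" "V \<inter> A = {}"
    unfolding U_def V_def using sep sep' \<open>e > 0\<close> by (force simp: dist_commute)+
  define L where "L = (if None \<in> K then - ball (0::complex) R else {})"
  have L: "z \<in> L \<longleftrightarrow> None \<in> K \<and> R \<le> norm z" for z by (auto simp: L_def)
  have "connected L"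
    unfolding L_def using connected_complement_bounded_convex[of "ball (0::complex) R"] by simp
  have LE: "L \<subseteq> ?E" using L unfolding enlarged_finite_part_def by auto
  have "U \<inter> V \<inter> L = {}" "L \<subseteq> U \<union> V" using LE E(1) UV by blast+
  with connectedD[OF \<open>connected L\<close> UV(1,2)] have "U \<inter> L = {} \<or> V \<inter> L = {}" .
  then have "L \<subseteq> A \<or> L \<subseteq> B"
    using LE E(1) UV by blast
  then show False
  proof
    assume "L \<subseteq> A"
    then show False
      using enlarged_finite_part_not_separated[OF K E(1) ne sep \<open>e > 0\<close>] L by blast
  next
    assume "L \<subseteq> B"
    then show False
      using enlarged_finite_part_not_separated[OF K E(2) ne(2,1) sep' \<open>e > 0\<close>] L by blast
  qed
qed

text \<open>
  The last step is a pause, so that every chain has positive length. In the concatenation below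
  each chain then occupies a nonempty interval of indices.
\<close>

lemma rtranclp_chain:
  assumes "r\<^sup>*\<^sup>* x y"
  obtains l c where "l > 0" "c 0 = x" "c l = y" "\<And>i. i < l \<Longrightarrow> r\<^sup>=\<^sup>= (c i) (c (Suc i))"
    "\<And>i. i \<le> l \<Longrightarrow> r\<^sup>*\<^sup>* x (c i)"
proof -
  obtain n where "(r ^^ n) x y" using assms rtranclp_imp_relpowp by metis
  then obtain f where f: "f 0 = x" "f n = y" "\<And>i. i < n \<Longrightarrow> r (f i) (f (Suc i))"
    unfolding relpowp_fun_conv by auto
  define c where "c = (\<lambda>i. f (min i n))"
  have step: "r\<^sup>=\<^sup>= (c i) (c (Suc i))" for i
    using f(3)[of i] by (cases "i < n") (auto simp: c_def min_def le_Suc_eq)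
  have "r\<^sup>*\<^sup>* x (c i)" for i
  proof (induction i)
    case (Suc i)
    then show ?case using step[of i] by auto
  qed (simp add: c_def f)
  moreover have "c 0 = x" "c (Suc n) = y" by (simp_all add: c_def f)
  ultimately show thesis using step that[of "Suc n" c] by blast
qed

lemma concatenate_chains:
  fixes r :: "nat \<Rightarrow> 'a \<Rightarrow> 'a \<Rightarrow> bool"
  assumes "\<And>k. (r k)\<^sup>*\<^sup>* (x k) (x (Suc k))"
  obtains w and N :: "nat \<Rightarrow> nat" where "strict_mono N" "\<And>k. w (N k) = x k"
    "\<And>k j. N k \<le> j \<Longrightarrow> j < N (Suc k) \<Longrightarrow> (r k)\<^sup>=\<^sup>= (w j) (w (Suc j))"
    "\<And>k j. N k \<le> j \<Longrightarrow> j < N (Suc k) \<Longrightarrow> (r k)\<^sup>*\<^sup>* (x k) (w j)"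
proof -
  have "\<exists>l c. l > 0 \<and> c 0 = x k \<and> c l = x (Suc k) \<and> (\<forall>i<l. (r k)\<^sup>=\<^sup>= (c i) (c (Suc i)))
      \<and> (\<forall>i\<le>l. (r k)\<^sup>*\<^sup>* (x k) (c i))" for k
    using rtranclp_chain[OF assms[of k]] by metis
  then obtain l c where l: "\<And>k. l k > (0::nat)" and c: "\<And>k. c k 0 = x k" "\<And>k. c k (l k) = x (Suc k)"
      "\<And>k i. i < l k \<Longrightarrow> (r k)\<^sup>=\<^sup>= (c k i) (c k (Suc i))"
      "\<And>k i. i \<le> l k \<Longrightarrow> (r k)\<^sup>*\<^sup>* (x k) (c k i)"
    by metis
  define N where "N = (\<lambda>k. \<Sum>i<k. l i)"
  have N: "strict_mono N" unfolding N_def strict_mono_Suc_iff using l by simp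
  have NS: "N (Suc k) = N k + l k" for k by (simp add: N_def)
  define idx where "idx = (\<lambda>j. LEAST k. j < N (Suc k))"
  have idx: "idx j = k" if "N k \<le> j" "j < N (Suc k)" for j k
    unfolding idx_def
  proof (rule Least_equality)
    fix m assume "j < N (Suc m)"
    with that(1) have "N k < N (Suc m)" by simp
    then show "k \<le> m" using N by (simp add: strict_mono_less)
  qed (rule that(2))
  define w where "w = (\<lambda>j. c (idx j) (j - N (idx j)))"
  have w: "w j = c k (j - N k)" if "N k \<le> j" "j < N (Suc k)" for j k
    using idx[OF that] by (simp add: w_def)
  have wN: "w (N k) = x k" for k using w[of k "N k"] l c(1) by (simp add: NS)
  show thesis
  proof
    fix k j assume kj: "N k \<le> j" "j < N (Suc k)"
    then have i: "j - N k < l k" by (auto simp: NS)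
    have "w (Suc j) = c k (Suc (j - N k))"
    proof (cases "Suc j < N (Suc k)")
      case True
      with kj show ?thesis using w[of k "Suc j"] by (simp add: Suc_diff_le)
    next
      case False
      with kj have "Suc j = N (Suc k)" "Suc (j - N k) = l k" by (auto simp: NS)
      then show ?thesis using wN c(2) by simp
    qed
    then show "(r k)\<^sup>=\<^sup>= (w j) (w (Suc j))" using w[OF kj] c(3)[OF i] by simp
    show "(r k)\<^sup>*\<^sup>* (x k) (w j)" using w[OF kj] c(4)[of "j - N k" k] i by simp
  qed (use N wN in auto)
qed

lemma strict_mono_interval_cover:
  fixes N :: "nat \<Rightarrow> nat"
  assumes "strict_mono N" "N n \<le> j"
  obtains k where "n \<le> k" "N k \<le> j" "j < N (Suc k)"
proof -
  have "\<exists>k. j < N (Suc k)"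
    using strict_mono_imp_increasing[OF assms(1), of "Suc j"] by (meson less_eq_Suc_le)
  define k where "k = (LEAST k. j < N (Suc k))"
  have k: "j < N (Suc k)" unfolding k_def by (rule LeastI_ex) fact
  with assms(2) have "N n < N (Suc k)" by linarith
  then have "n \<le> k" using assms(1) by (simp add: strict_mono_less)
  moreover have "N k \<le> j"
  proof (cases "k = n")
    case False
    with \<open>n \<le> k\<close> obtain m where m: "k = Suc m" by (cases k) auto
    show ?thesis
    proof (rule ccontr)
      assume "\<not> N k \<le> j"
      then have "k \<le> m" unfolding m k_def[unfolded m, symmetric] using k_def m by (metis Least_le not_le)
      with m show False by simp
    qed
  qed (use assms in simp)
  ultimately show thesis using k that by blast
qed

lemma recurrent_enumeration:
  assumes "countable T" "T \<noteq> {}"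
  obtains \<tau> :: "nat \<Rightarrow> 'a" where "\<And>k. \<tau> k \<in> T" "\<And>t n. t \<in> T \<Longrightarrow> \<exists>k\<ge>n. \<tau> k = t"
proof
  fix t and n :: nat
  assume "t \<in> T"
  then obtain i where i: "from_nat_into T i = t"
    using assms by (metis from_nat_into_surj)
  show "\<exists>k\<ge>n. from_nat_into T (fst (prod_decode k)) = t"
    using i le_prod_encode_2[of n i] by (intro exI[of _ "prod_encode (i, n)"]) simp
qed (use assms in \<open>simp add: from_nat_into\<close>)

text \<open>
  The sequence visits, again and again, every point of a countable dense subset of the finite
  part of \<open>K\<close>, and, if \<open>\<infinity> \<in> K\<close>, also the integers \<open>k\<close>, which represent \<open>\<infinity>\<close>. From the \<open>k\<close>-th visit
  to the next it moves in steps shorter than \<open>1 / (k + 1)\<close> inside the enlarged finite part with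
  \<open>R = k\<close>. The visits make every point of \<open>K\<close> a limit point; since the enlargements shrink
  to \<open>K\<close>, there are no others.
\<close>

lemma continuum_is_cluster_set_of_slow_sequence:
  assumes K: "continuum_in riemann_sphere K"
  obtains w :: "nat \<Rightarrow> complex" where "(\<lambda>n. w (Suc n) - w n) \<longlonglongrightarrow> 0"
    "\<And>v. v \<in> K \<longleftrightarrow> (\<exists>\<rho>. filterlim \<rho> at_top sequentially \<and>
       limitin riemann_sphere (\<lambda>n. Some (w (\<rho> n))) v sequentially)"
proof -
  define E where "E = (\<lambda>n::nat. enlarged_finite_part K (real n))"
  have E_anti: "m \<le> n \<Longrightarrow> E n \<subseteq> E m" for m n
    unfolding E_def enlarged_finite_part_def by auto
  obtain D where D: "countable D" "D \<subseteq> Some -` K" "Some -` K \<subseteq> closure D"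
    using separable by blast
  define T where "T = Some ` D \<union> (K \<inter> {None})"
  have "T \<noteq> {}"
  proof -
    obtain v where v: "v \<in> K" using K unfolding continuum_in_def by blast
    show ?thesis
    proof (cases v)
      case (Some z)
      with v D(3) have "D \<noteq> {}" by auto
      then show ?thesis unfolding T_def by simp
    qed (use v in \<open>auto simp: T_def\<close>)
  qed
  moreover have "countable T" unfolding T_def using D(1) by (simp add: countable_Int2)
  ultimately obtain \<tau> where \<tau>: "\<And>k::nat. \<tau> k \<in> T" "\<And>t n. t \<in> T \<Longrightarrow> \<exists>k\<ge>n. \<tau> k = t"
    using recurrent_enumeration by metis
  define x :: "nat \<Rightarrow> complex" where "x = (\<lambda>k. case \<tau> k of Some d \<Rightarrow> d | None \<Rightarrow> of_nat k)"
  have x: "x k \<in> E k" for k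
    using \<tau>(1)[of k] D(2)
    by (auto simp: x_def T_def E_def enlarged_finite_part_def split: option.splits)
  have "(chain_step (E k) (1 / Suc k))\<^sup>*\<^sup>* (x k) (x (Suc k))" for k
  proof -
    have "x (Suc k) \<in> E k" using x[of "Suc k"] E_anti[of k "Suc k"] by auto
    then show ?thesis using x[of k] unfolding E_def
      by (intro enlarged_finite_part_chain_connected[OF K]) auto
  qed
  from concatenate_chains[of "\<lambda>k. chain_step (E k) (1 / Suc k)" x, OF this] obtain w N where N: "strict_mono N"
    and wN: "\<And>k. w (N k) = x k"
    and step: "\<And>k j. N k \<le> j \<Longrightarrow> j < N (Suc k) \<Longrightarrow> (chain_step (E k) (1 / Suc k))\<^sup>=\<^sup>= (w j) (w (Suc j))"
    and reach: "\<And>k j. N k \<le> j \<Longrightarrow> j < N (Suc k) \<Longrightarrow> (chain_step (E k) (1 / Suc k))\<^sup>*\<^sup>* (x k) (w j)"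
    by metis
  have tail: "w j \<in> E n \<and> dist (w j) (w (Suc j)) < 1 / Suc n" if j: "N n \<le> j" for n j
  proof -
    obtain k where k: "n \<le> k" "N k \<le> j" "j < N (Suc k)"
      using strict_mono_interval_cover[OF N j] .
    have "w j \<in> E k"
      using reach[OF k(2,3)] x[of k] by (induction rule: rtranclp.induct) (auto simp: chain_step_def)
    moreover have "dist (w j) (w (Suc j)) < 1 / Suc k"
      using step[OF k(2,3)] by (auto simp: chain_step_def)
    moreover have "1 / Suc k \<le> 1 / Suc n" using k(1) by (simp add: frac_le)
    ultimately show ?thesis using E_anti[OF k(1)] by fastforce
  qed
  have lim: "(\<lambda>n. w (Suc n) - w n) \<longlonglongrightarrow> 0"
  proof (rule LIMSEQ_I)
    fix e :: real assume "e > 0"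
    then obtain n where n: "1 / Suc n < e" using nat_approx_posE by blast
    have "norm (w (Suc j) - w j - 0) < e" if "N n \<le> j" for j
      using tail[OF that] n by (simp add: dist_norm norm_minus_commute)
    then show "\<exists>no. \<forall>j\<ge>no. norm (w (Suc j) - w j - 0) < e" by blast
  qed
  have closed: "closedin riemann_sphere K" using closedin_riemann_sphere[OF K] .
  have "v \<in> K" if \<rho>: "filterlim \<rho> at_top sequentially"
    and v: "limitin riemann_sphere (\<lambda>n. Some (w (\<rho> n))) v sequentially" for v \<rho>
  proof -
    have inE: "\<forall>\<^sub>F n in sequentially. w (\<rho> n) \<in> E m" for m
      using \<rho>[unfolded filterlim_at_top, rule_format, of "N m"] by eventually_elim (use tail in blast)
    \<comment> \<open>A bounded sequence eventually avoids the part added near \<open>\<infinity>\<close>, hence lies in \<open>K\<close> itself.\<close>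
    have ev: "\<forall>\<^sub>F n in sequentially. Some (w (\<rho> n)) \<in> K" if "None \<notin> K \<or> v \<noteq> None"
    proof (cases "None \<in> K")
      case False
      then show ?thesis using inE[of 0] by (simp add: E_def enlarged_finite_part_def)
    next
      case True
      with that obtain z where z: "v = Some z" by blast
      then have "(\<lambda>n. w (\<rho> n)) \<longlonglongrightarrow> z" using v by (simp add: limitin_riemann_sphere_Some)
      then have "(\<lambda>n. norm (w (\<rho> n))) \<longlonglongrightarrow> norm z" by (rule tendsto_norm)
      moreover obtain m :: nat where m: "norm z < real m" using reals_Archimedean2 by blast
      ultimately have "\<forall>\<^sub>F n in sequentially. norm (w (\<rho> n)) < real m" by (rule order_tendstoD)
      then show ?thesis
        using inE[of m] by eventually_elim (auto simp: E_def enlarged_finite_part_def)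
    qed
    show "v \<in> K"
    proof (cases "None \<notin> K \<or> v \<noteq> None")
      case True
      from limitin_closedin[OF v closed ev[OF True]] show ?thesis by simp
    qed auto
  qed
  moreover have "\<exists>\<rho>. filterlim \<rho> at_top sequentially \<and>
       limitin riemann_sphere (\<lambda>n. Some (w (\<rho> n))) v sequentially" if v: "v \<in> K" for v
  proof (cases v)
    case None
    with v have "None \<in> T" by (simp add: T_def)
    with \<tau>(2) obtain \<kappa> where \<kappa>: "\<And>n. \<kappa> n \<ge> n" "\<And>n. \<tau> (\<kappa> n) = None" by metis
    have \<kappa>_lim: "filterlim \<kappa> at_top sequentially"
      using \<kappa>(1) by (rule filterlim_at_top_mono[OF filterlim_ident always_eventually[OF allI]])
    have "filterlim (\<lambda>n. of_nat (\<kappa> n) :: complex) at_infinity sequentially"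
      by (rule filterlim_compose[OF tendsto_of_nat \<kappa>_lim])
    then have "filterlim (\<lambda>n. w (N (\<kappa> n))) at_infinity sequentially"
      unfolding wN x_def \<kappa>(2) by simp
    moreover have "filterlim (\<lambda>n. N (\<kappa> n)) at_top sequentially"
      using filterlim_compose[OF filterlim_subseq[OF N] \<kappa>_lim] .
    ultimately show ?thesis
      unfolding None limitin_riemann_sphere_None by (intro exI[of _ "\<lambda>n. N (\<kappa> n)"]) simp
  next
    case (Some z)
    with v D(3) have "z \<in> closure D" by auto
    then obtain d where d: "\<And>n. d n \<in> D" "d \<longlonglongrightarrow> z" unfolding closure_sequential by blast
    have "\<exists>k\<ge>n. \<tau> k = Some (d n)" for n using \<tau>(2) d(1) by (auto simp: T_def)
    then obtain \<kappa> where \<kappa>: "\<And>n. \<kappa> n \<ge> n" "\<And>n. \<tau> (\<kappa> n) = Some (d n)" by metis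
    have \<kappa>_lim: "filterlim \<kappa> at_top sequentially"
      using \<kappa>(1) by (rule filterlim_at_top_mono[OF filterlim_ident always_eventually[OF allI]])
    have "(\<lambda>n. w (N (\<kappa> n))) \<longlonglongrightarrow> z"
      unfolding wN x_def \<kappa>(2) using d(2) by simp
    moreover have "filterlim (\<lambda>n. N (\<kappa> n)) at_top sequentially"
      using filterlim_compose[OF filterlim_subseq[OF N] \<kappa>_lim] .
    ultimately show ?thesis
      unfolding Some limitin_riemann_sphere_Some by (intro exI[of _ "\<lambda>n. N (\<kappa> n)"]) simp
  qed
  ultimately show thesis using that[OF lim] by blast
qed

section \<open>Entire interpolation on a logarithmic time scale\<close>

text \<open>
  The summand with index \<open>n\<close> performs the step from \<open>w n\<close> to \<open>w (n + 1)\<close> around the time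
  \<open>\<bar>t\<bar> = 2 ^ n\<close>.
\<close>

definition log_interpolant :: "(nat \<Rightarrow> complex) \<Rightarrow> complex \<Rightarrow> complex" where
  "log_interpolant w z = w 0 + (\<Sum>n. (w (Suc n) - w n) * (1 - exp (- (z / 2 ^ n)\<^sup>2)))"

definition log_index :: "real \<Rightarrow> nat" where
  "log_index t = nat \<lfloor>log 2 \<bar>t\<bar>\<rfloor>"

lemma log_index_uminus [simp]: "log_index (- t) = log_index t"
  by (simp add: log_index_def)

lemma log_interpolant_uminus [simp]: "log_interpolant w (- z) = log_interpolant w z"
  by (simp add: log_interpolant_def)

lemma log_index_power2 [simp]: "log_index (2 ^ n) = n"
  by (simp add: log_index_def log_nat_power)

lemma log_index_bounds:
  assumes "t \<ge> 1"
  shows "2 ^ log_index t \<le> t" "t < 2 ^ Suc (log_index t)"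
proof -
  have nn: "0 \<le> \<lfloor>log 2 t\<rfloor>" using assms by simp
  then have eq: "real (log_index t) = of_int \<lfloor>log 2 t\<rfloor>"
    using assms by (simp add: log_index_def)
  then have "real (log_index t) \<le> log 2 t" by simp
  then have "2 powr real (log_index t) \<le> t" using assms by (simp add: le_log_iff)
  then show "2 ^ log_index t \<le> t" by (simp add: powr_realpow)
  have "log 2 t < real (Suc (log_index t))" using eq by linarith
  then have "t < 2 powr real (Suc (log_index t))" using assms by (subst (asm) log_less_iff) auto
  then show "t < 2 ^ Suc (log_index t)" using powr_realpow[of 2 "Suc (log_index t)"] by simp
qed

lemma log_index_at_top: "filterlim log_index at_top at_top"
  unfolding filterlim_at_top
proof
  fix n
  show "\<forall>\<^sub>F t in at_top. n \<le> log_index t"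
    using eventually_ge_at_top[of "2 ^ n :: real"]
  proof eventually_elim
    case (elim t)
    moreover have "(1::real) \<le> 2 ^ n" by simp
    ultimately have "1 \<le> t" by linarith
    with elim have "2 ^ n < (2::real) ^ Suc (log_index t)" using log_index_bounds(2) by fastforce
    then have "n < Suc (log_index t)" by (rule power_less_imp_less_exp[rotated]) simp
    then show ?case by simp
  qed
qed

lemma norm_one_minus_exp_le: "norm (1 - exp u) \<le> exp (norm u) * norm (u :: complex)"
proof -
  have "norm (exp 0 - exp u) \<le> exp (norm u) * norm (0 - u)"
    by (rule field_differentiable_bound[of "cball 0 (norm u)" exp exp])
       (auto intro!: derivative_eq_intros order.trans[OF complex_Re_le_cmod])
  then show ?thesis by simp
qed

text \<open>
  This holds because \<open>2 \<bar>x\<bar> \<le> 1 + x\<^sup>2 \<le> exp (x\<^sup>2)\<close>.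
\<close>

lemma exp_neg_square_Lipschitz: "\<bar>exp (- x\<^sup>2) - exp (- y\<^sup>2)\<bar> \<le> \<bar>x - y :: real\<bar>"
proof -
  have "norm (exp (- x\<^sup>2) - exp (- y\<^sup>2)) \<le> 1 * norm (x - y)"
  proof (rule field_differentiable_bound[of UNIV _ "\<lambda>x. - 2 * x * exp (- x\<^sup>2)"])
    fix z :: real
    have "0 \<le> (\<bar>z\<bar> - 1)\<^sup>2" by simp
    then have "2 * \<bar>z\<bar> \<le> 1 + z\<^sup>2" by (simp add: power2_eq_square algebra_simps)
    also have "\<dots> \<le> exp (z\<^sup>2)" by simp
    finally have "2 * \<bar>z\<bar> * exp (- z\<^sup>2) \<le> exp (z\<^sup>2) * exp (- z\<^sup>2)"
      by (intro mult_right_mono) auto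
    then show "norm (- 2 * z * exp (- z\<^sup>2)) \<le> 1" by (simp add: abs_mult flip: exp_add)
  qed (auto intro!: derivative_eq_intros)
  then show ?thesis by simp
qed

context
  fixes w :: "nat \<Rightarrow> complex" and B :: real
  assumes B: "\<And>n. norm (w (Suc n) - w n) \<le> B"
begin

lemma log_interpolant_term_bound:
  assumes "norm z \<le> R"
  shows "norm ((w (Suc n) - w n) * (1 - exp (- (z / 2 ^ n)\<^sup>2))) \<le> B * exp (R\<^sup>2) * R\<^sup>2 * (1/4) ^ n"
proof -
  have "norm (- (z / 2 ^ n)\<^sup>2) = (norm z)\<^sup>2 * (1/4) ^ n"
    by (simp add: norm_power norm_divide norm_mult power_divide power2_eq_square flip: power_mult_distrib)
  also have "\<dots> \<le> R\<^sup>2 * (1/4) ^ n"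
    using assms by (intro mult_right_mono power_mono) auto
  finally have u: "norm (- (z / 2 ^ n)\<^sup>2) \<le> R\<^sup>2 * (1/4) ^ n" .
  moreover have "R\<^sup>2 * (1/4) ^ n \<le> R\<^sup>2 * 1"
    by (intro mult_left_mono power_le_one) auto
  ultimately have "exp (norm (- (z / 2 ^ n)\<^sup>2)) \<le> exp (R\<^sup>2)" by simp
  with u have "norm (1 - exp (- (z / 2 ^ n)\<^sup>2)) \<le> exp (R\<^sup>2) * (R\<^sup>2 * (1/4) ^ n)"
    by (intro order.trans[OF norm_one_minus_exp_le] mult_mono) auto
  moreover have "0 \<le> B" using B[of 0] norm_ge_zero order.trans by blast
  ultimately have "norm (w (Suc n) - w n) * norm (1 - exp (- (z / 2 ^ n)\<^sup>2)) \<le> B * (exp (R\<^sup>2) * (R\<^sup>2 * (1/4) ^ n))"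
    using B by (intro mult_mono) auto
  then show ?thesis by (simp add: norm_mult mult.assoc)
qed

lemma log_interpolant_bound_summable: "summable (\<lambda>n. B * exp (R\<^sup>2) * R\<^sup>2 * (1/4 :: real) ^ n)"
  by (intro summable_mult summable_geometric) simp

lemma log_interpolant_summable: "summable (\<lambda>n. (w (Suc n) - w n) * (1 - exp (- (z / 2 ^ n)\<^sup>2)))"
  by (rule summable_comparison_test'[OF log_interpolant_bound_summable[of "norm z"], of 0])
     (rule log_interpolant_term_bound, simp)

lemma log_interpolant_holomorphic: "log_interpolant w holomorphic_on UNIV"
proof (rule holomorphic_uniform_sequence[of _ "\<lambda>N z. w 0 + (\<Sum>n<N. (w (Suc n) - w n) * (1 - exp (- (z / 2 ^ n)\<^sup>2)))"])
  fix x :: complex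
  have "uniform_limit (cball x 1) (\<lambda>N z. \<Sum>n<N. (w (Suc n) - w n) * (1 - exp (- (z / 2 ^ n)\<^sup>2)))
      (\<lambda>z. \<Sum>n. (w (Suc n) - w n) * (1 - exp (- (z / 2 ^ n)\<^sup>2))) sequentially"
  proof (rule Weierstrass_m_test[OF _ log_interpolant_bound_summable[of "norm x + 1"]])
    fix n z assume "z \<in> cball x 1"
    then have "norm z \<le> norm x + 1"
      using norm_triangle_sub[of z x] by (simp add: dist_norm norm_minus_commute)
    then show "norm ((w (Suc n) - w n) * (1 - exp (- (z / 2 ^ n)\<^sup>2)))
        \<le> B * exp ((norm x + 1)\<^sup>2) * (norm x + 1)\<^sup>2 * (1/4) ^ n"
      by (rule log_interpolant_term_bound)
  qed
  then have "uniform_limit (cball x 1) (\<lambda>N z. w 0 + (\<Sum>n<N. (w (Suc n) - w n) * (1 - exp (- (z / 2 ^ n)\<^sup>2))))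
      (log_interpolant w) sequentially"
    unfolding log_interpolant_def by (intro uniform_limit_add uniform_limit_const)
  then show "\<exists>d>0. cball x d \<subseteq> UNIV \<and> uniform_limit (cball x d)
      (\<lambda>N z. w 0 + (\<Sum>n<N. (w (Suc n) - w n) * (1 - exp (- (z / 2 ^ n)\<^sup>2)))) (log_interpolant w) sequentially"
    by (intro exI[of _ 1]) auto
qed (auto intro!: holomorphic_intros)

text \<open>
  The \<open>n\<close>-th summand is Lipschitz with constant \<open>B / 2 ^ n\<close>.
\<close>

lemma log_interpolant_Lipschitz:
  "norm (log_interpolant w (of_real s) - log_interpolant w (of_real t)) \<le> 2 * B * \<bar>s - t\<bar>"
proof -
  have geo: "(\<lambda>n. B * \<bar>s - t\<bar> * (1/2) ^ n) sums (B * \<bar>s - t\<bar> * 2)"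
    using geometric_sums[of "1/2 :: real"] by (intro sums_mult) simp
  have "log_interpolant w (of_real s) - log_interpolant w (of_real t) =
      (\<Sum>n. (w (Suc n) - w n) * (1 - exp (- (of_real s / 2 ^ n)\<^sup>2))
        - (w (Suc n) - w n) * (1 - exp (- (of_real t / 2 ^ n)\<^sup>2)))"
    by (simp add: log_interpolant_def suminf_diff[OF log_interpolant_summable log_interpolant_summable])
  also have "norm \<dots> \<le> (\<Sum>n. B * \<bar>s - t\<bar> * (1/2) ^ n)"
  proof (rule norm_suminf_le)
    fix n
    have real: "exp (- (complex_of_real r / 2 ^ n)\<^sup>2) = of_real (exp (- (r / 2 ^ n)\<^sup>2))" for r
      by (simp flip: exp_of_real)
    have "norm ((w (Suc n) - w n) * (1 - exp (- (of_real s / 2 ^ n)\<^sup>2))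
        - (w (Suc n) - w n) * (1 - exp (- (of_real t / 2 ^ n)\<^sup>2)))
      = norm (w (Suc n) - w n) * \<bar>exp (- (s / 2 ^ n)\<^sup>2) - exp (- (t / 2 ^ n)\<^sup>2)\<bar>"
      unfolding real norm_of_real[where 'a = complex, symmetric] norm_mult[symmetric]
      by (subst (2) norm_minus_cancel[symmetric]) (simp add: algebra_simps)
    also have "\<dots> \<le> B * \<bar>s / 2 ^ n - t / 2 ^ n\<bar>"
      using B[of n] order.trans[OF norm_ge_zero B[of n]]
      by (intro mult_mono exp_neg_square_Lipschitz) auto
    also have "s / 2 ^ n - t / 2 ^ n = (s - t) * (1/2) ^ n"
      by (simp add: power_divide diff_divide_distrib)
    finally show "norm ((w (Suc n) - w n) * (1 - exp (- (of_real s / 2 ^ n)\<^sup>2))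
        - (w (Suc n) - w n) * (1 - exp (- (of_real t / 2 ^ n)\<^sup>2))) \<le> B * \<bar>s - t\<bar> * (1/2) ^ n"
      by (simp add: abs_mult mult.assoc)
  qed (use geo sums_summable in blast)
  also have "\<dots> = 2 * B * \<bar>s - t\<bar>" using sums_unique[OF geo] by simp
  finally show ?thesis .
qed

lemma log_interpolant_linear_growth:
  "norm (log_interpolant w (of_real t)) \<le> norm (w 0) + 2 * B * \<bar>t\<bar>"
proof -
  have "log_interpolant w 0 = w 0" by (simp add: log_interpolant_def)
  then show ?thesis
    using log_interpolant_Lipschitz[of t 0] norm_triangle_sub[of "log_interpolant w (of_real t)" "w 0"] by simp
qed

text \<open>
  A step with \<open>n < m\<close> is already completed up to \<open>exp (-(t / 2 ^ n)\<^sup>2) \<le> 4 ^ (n - m)\<close>, and a step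
  with \<open>n \<ge> m\<close> has progressed by at most \<open>(t / 2 ^ n)\<^sup>2 \<le> 4 * 4 ^ (m - n)\<close>. The errors are indexed
  by the distance \<open>j\<close> from \<open>m\<close>, so that for fixed \<open>j\<close> they can be compared as \<open>m\<close> grows.
\<close>

lemma log_interpolant_error_le:
  fixes t :: real and m :: nat
  assumes m: "2 ^ m \<le> t" "t < 2 ^ Suc m"
  defines "a \<equiv> \<lambda>j. (if j < m then norm (w (Suc (m - Suc j)) - w (m - Suc j)) else 0) * (1/4) ^ Suc j
      + norm (w (Suc (m + j)) - w (m + j)) * (4 * (1/4) ^ j)"
  shows "norm (log_interpolant w (of_real t) - w m) \<le> suminf a"
proof -
  define d where "d = (\<lambda>n. w (Suc n) - w n)"
  define e where "e = (\<lambda>n. exp (- (t / 2 ^ n)\<^sup>2))"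
  define u where "u = (\<lambda>n. d n * (of_real (1 - e n) - (if n < m then 1 else 0)))"
  have "t > 0" using m(1) by (smt (verit) zero_less_power)
  have expe: "exp (- (complex_of_real t / 2 ^ n)\<^sup>2) = of_real (e n)" for n
    by (simp add: e_def flip: exp_of_real)
  have s1: "(\<lambda>n. d n * of_real (1 - e n)) sums (log_interpolant w (of_real t) - w 0)"
    using summable_sums[OF log_interpolant_summable[of "of_real t"]]
    by (simp add: log_interpolant_def d_def expe)
  have "(\<lambda>n. if n \<in> {..<m} then d n else 0) sums (\<Sum>n<m. d n)"
    by (rule sums_If_finite_set) simp
  also have "(\<Sum>n<m. d n) = w m - w 0" by (simp add: d_def sum_lessThan_telescope)
  finally have s2: "(\<lambda>n. if n < m then d n else 0) sums (w m - w 0)" by simp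
  have "u = (\<lambda>n. d n * of_real (1 - e n) - (if n < m then d n else 0))"
    by (auto simp: u_def algebra_simps)
  with sums_diff[OF s1 s2] have u: "u sums (log_interpolant w (of_real t) - w m)" by simp
  have head: "norm (u n) \<le> norm (d n) * (1/4) ^ (m - n)" if n: "n < m" for n
  proof -
    have "2 ^ (m - n) \<le> t / 2 ^ n"
      using m(1) n by (simp add: pos_le_divide_eq flip: power_add)
    then have "(2 ^ (m - n))\<^sup>2 \<le> (t / 2 ^ n)\<^sup>2" by (intro power_mono) auto
    then have "4 ^ (m - n) \<le> (t / 2 ^ n)\<^sup>2"
      by (simp add: power2_eq_square flip: power_mult_distrib)
    also have "\<dots> \<le> exp ((t / 2 ^ n)\<^sup>2)"
      using exp_ge_add_one_self[of "(t / 2 ^ n)\<^sup>2"] by linarith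
    finally have "e n \<le> 1 / 4 ^ (m - n)"
      unfolding e_def exp_minus inverse_eq_divide by (intro divide_left_mono) auto
    moreover have "norm (u n) = norm (d n) * e n"
      using n by (simp add: u_def norm_mult e_def)
    ultimately show ?thesis
      using mult_left_mono[of "e n" "1 / 4 ^ (m - n)" "norm (d n)"] by (simp add: power_divide)
  qed
  have tail: "norm (u (m + j)) \<le> norm (d (m + j)) * (4 * (1/4) ^ j)" for j
  proof -
    have "t / 2 ^ (m + j) \<le> 2 * (1/2) ^ j"
      using m(2) by (simp add: pos_divide_le_eq power_add power_divide)
    then have "(t / 2 ^ (m + j))\<^sup>2 \<le> (2 * (1/2) ^ j)\<^sup>2"
      using \<open>t > 0\<close> by (intro power_mono) auto
    also have "(2 * (1/2) ^ j)\<^sup>2 = 4 * (1/4 :: real) ^ j"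
    proof -
      have "((1/2 :: real) ^ j)\<^sup>2 = ((1/2)\<^sup>2) ^ j" by (metis power_mult mult.commute)
      also have "(1/2 :: real)\<^sup>2 = 1/4" by (simp add: power2_eq_square)
      finally show ?thesis by (simp only: power_mult_distrib) simp
    qed
    finally have "1 - e (m + j) \<le> 4 * (1/4) ^ j"
      using exp_ge_add_one_self[of "- (t / 2 ^ (m + j))\<^sup>2"] unfolding e_def by linarith
    moreover have "e (m + j) \<le> 1" by (simp add: e_def)
    moreover have "u (m + j) = d (m + j) * of_real (1 - e (m + j))" by (simp add: u_def)
    then have "norm (u (m + j)) = norm (d (m + j)) * \<bar>1 - e (m + j)\<bar>"
      by (simp only: norm_mult norm_of_real)
    ultimately show ?thesis by (auto intro!: mult_left_mono)
  qed
  have "summable (\<lambda>j. norm (d (m + j)) * (4 * (1/4) ^ j))"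
  proof (rule summable_comparison_test'[of "\<lambda>j. B * (4 * (1/4 :: real) ^ j)" 0])
    show "summable (\<lambda>j. B * (4 * (1/4 :: real) ^ j))" by (intro summable_mult summable_geometric) simp
    show "norm (norm (d (m + j)) * (4 * (1/4) ^ j)) \<le> B * (4 * (1/4) ^ j)" for j
      using B by (auto simp: d_def intro!: mult_right_mono)
  qed
  note sums_tail = summable_sums[OF this]
  have sums_head: "(\<lambda>j. if j \<in> {..<m} then norm (d (m - Suc j)) * (1/4) ^ Suc j else 0) sums
      (\<Sum>j<m. norm (d (m - Suc j)) * (1/4) ^ Suc j)"
    by (rule sums_If_finite_set) simp
  have "a = (\<lambda>j. (if j \<in> {..<m} then norm (d (m - Suc j)) * (1/4) ^ Suc j else 0)
      + norm (d (m + j)) * (4 * (1/4) ^ j))"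
    by (auto simp: a_def d_def)
  with sums_add[OF sums_head sums_tail]
  have "a sums ((\<Sum>j<m. norm (d (m - Suc j)) * (1/4) ^ Suc j) + (\<Sum>j. norm (d (m + j)) * (4 * (1/4) ^ j)))" by simp
  then have a: "suminf a = (\<Sum>j<m. norm (d (m - Suc j)) * (1/4) ^ Suc j) + (\<Sum>j. norm (d (m + j)) * (4 * (1/4) ^ j))"
    by (rule sums_unique[symmetric])
  have "log_interpolant w (of_real t) - w m = (\<Sum>n. u (n + m)) + (\<Sum>n<m. u n)"
    using suminf_split_initial_segment[OF sums_summable[OF u], of m] sums_unique[OF u] by simp
  also have "norm \<dots> \<le> norm (\<Sum>n. u (n + m)) + norm (\<Sum>n<m. u n)"
    by (rule norm_triangle_ineq)
  also have "norm (\<Sum>n<m. u n) \<le> (\<Sum>n<m. norm (d n) * (1/4) ^ (m - n))"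
    by (rule sum_norm_le) (use head in simp)
  also have "\<dots> = (\<Sum>j<m. norm (d (m - Suc j)) * (1/4) ^ Suc j)"
    by (subst sum.nat_diff_reindex[symmetric]) (auto intro!: sum.cong simp: Suc_diff_Suc)
  also have "norm (\<Sum>n. u (n + m)) \<le> (\<Sum>j. norm (d (m + j)) * (4 * (1/4) ^ j))"
    by (rule norm_suminf_le) (use tail sums_tail in \<open>auto simp: add.commute sums_iff\<close>)
  finally show ?thesis unfolding a by simp
qed

text \<open>
  For fixed distance \<open>j\<close> the terms of the error bound tend to \<open>0\<close> with the steps of \<open>w\<close>, and they
  are dominated by a geometric series; Tannery's theorem gives the limit.
\<close>

lemma log_interpolant_asymptotic:
  assumes "(\<lambda>n. w (Suc n) - w n) \<longlonglongrightarrow> 0"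
  shows "((\<lambda>t. log_interpolant w (of_real t) - w (log_index t)) \<longlongrightarrow> 0) at_top"
proof -
  define d where "d = (\<lambda>n. norm (w (Suc n) - w n))"
  define a where "a = (\<lambda>j m. (if j < m then d (m - Suc j) else 0) * (1/4) ^ Suc j + d (m + j) * (4 * (1/4) ^ j))"
  have d: "d \<longlonglongrightarrow> 0" unfolding d_def using assms tendsto_norm_zero by blast
  have dB: "0 \<le> d n" "d n \<le> B" for n using B by (auto simp: d_def)
  then have B0: "0 \<le> B" using order.trans by blast
  have "a j \<longlonglongrightarrow> 0" for j
  proof -
    have "(\<lambda>m. if j < m then d (m - Suc j) else 0) \<longlonglongrightarrow> 0"
    proof (rule Lim_transform_eventually)
      show "(\<lambda>m. d (m - Suc j)) \<longlonglongrightarrow> 0"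
        by (rule filterlim_compose[OF d filterlim_minus_const_nat_at_top])
      show "\<forall>\<^sub>F m in sequentially. d (m - Suc j) = (if j < m then d (m - Suc j) else 0)"
        using eventually_gt_at_top[of j] by eventually_elim simp
    qed
    moreover have "(\<lambda>m. d (m + j)) \<longlonglongrightarrow> 0" using d by (rule LIMSEQ_ignore_initial_segment)
    ultimately have "a j \<longlonglongrightarrow> 0 * (1/4) ^ Suc j + 0 * (4 * (1/4) ^ j)"
      unfolding a_def by (intro tendsto_intros)
    then show ?thesis by simp
  qed
  moreover have "norm (a j m) \<le> 5 * B * (1/4) ^ j" for j m
  proof -
    have "(if j < m then d (m - Suc j) else 0) * (1/4) ^ Suc j \<le> B * (1/4) ^ j"
      using dB B0 by (intro mult_mono) auto
    moreover have "d (m + j) * (4 * (1/4) ^ j) \<le> B * (4 * (1/4) ^ j)"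
      using dB by (intro mult_right_mono) auto
    moreover have "0 \<le> a j m" using dB by (auto simp: a_def)
    moreover have "a j m = (if j < m then d (m - Suc j) else 0) * (1/4) ^ Suc j + d (m + j) * (4 * (1/4) ^ j)"
      by (simp only: a_def)
    ultimately have "a j m \<le> B * (1/4) ^ j + B * (4 * (1/4) ^ j)" by linarith
    also have "\<dots> = 5 * B * (1/4) ^ j" by simp
    finally show ?thesis using \<open>0 \<le> a j m\<close> by simp
  qed
  then have "\<forall>\<^sub>F (j, m) in at_top \<times>\<^sub>F sequentially. norm (a j m) \<le> 5 * B * (1/4) ^ j"
    by (intro always_eventually) auto
  moreover have "summable (\<lambda>j. 5 * B * (1/4 :: real) ^ j)"
    by (intro summable_mult summable_geometric) simp
  ultimately have "(\<lambda>m. \<Sum>j. a j m) \<longlonglongrightarrow> (\<Sum>j. 0)"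
    using tannerys_theorem[of a "\<lambda>_. 0" sequentially] by simp
  then have lim: "((\<lambda>t. \<Sum>j. a j (log_index t)) \<longlongrightarrow> 0) at_top"
    using filterlim_compose[OF _ log_index_at_top] by simp
  show ?thesis
  proof (rule Lim_null_comparison[OF _ lim])
    show "\<forall>\<^sub>F t in at_top. norm (log_interpolant w (of_real t) - w (log_index t)) \<le> (\<Sum>j. a j (log_index t))"
      using eventually_ge_at_top[of 1]
    proof eventually_elim
      case (elim t)
      from log_interpolant_error_le[OF log_index_bounds[OF elim]] show ?case
        by (simp only: a_def d_def)
    qed
  qed
qed

end

text \<open>
  The complex derivative can be computed along the real line.
\<close>

lemma norm_deriv_le_of_real_Lipschitz:
  assumes "f field_differentiable at (complex_of_real t)"
    and "\<And>s. norm (f (of_real s) - f (of_real t)) \<le> C * \<bar>s - t\<bar>"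
  shows "norm (deriv f (of_real t)) \<le> C"
proof (rule Lim_norm_ubound)
  have "((\<lambda>y. (f y - f (of_real t)) / (y - of_real t)) \<longlongrightarrow> deriv f (of_real t)) (at (of_real t))"
    using assms(1) by (simp add: field_differentiable_derivI flip: has_field_derivative_iff)
  moreover have "filterlim of_real (at (complex_of_real t)) (at t)"
    by (auto simp: filterlim_at eventually_at_filter intro!: tendsto_intros)
  ultimately show "((\<lambda>s. (f (of_real s) - f (of_real t)) / (of_real s - of_real t)) \<longlongrightarrow> deriv f (of_real t)) (at t)"
    by (rule filterlim_compose)
  show "\<forall>\<^sub>F s in at t. norm ((f (of_real s) - f (of_real t)) / (of_real s - of_real t)) \<le> C"
    unfolding eventually_at_filter
  proof (intro always_eventually allI impI)
    fix s assume "s \<noteq> t"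
    then show "norm ((f (of_real s) - f (of_real t)) / (of_real s - of_real t)) \<le> C"
      using assms(2)[of s] by (simp add: norm_divide pos_divide_le_eq flip: of_real_diff)
  qed
qed simp

section \<open>Joining the two ends\<close>

text \<open>
  An entire function that on the real line increases from \<open>0\<close> at \<open>-\<infinity>\<close> to \<open>1\<close> at \<open>+\<infinity>\<close> and
  approaches these limits faster than any negative power of \<open>\<bar>t\<bar>\<close>.
\<close>

definition switch :: "complex \<Rightarrow> complex" where
  "switch z = exp (- exp (- z))"

lemma switch_of_real: "switch (of_real t) = of_real (exp (- exp (- t)))"
  by (simp add: switch_def flip: exp_of_real)

lemma switch_has_field_derivative:
  "(switch has_field_derivative exp (- z) * switch z) (at z)"
  unfolding switch_def by (auto intro!: derivative_eq_intros)

lemma switch_holomorphic [holomorphic_intros]: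
  "f holomorphic_on S \<Longrightarrow> (\<lambda>z. switch (f z)) holomorphic_on S"
  unfolding switch_def by (intro holomorphic_intros)

locale real_linear_growth =
  fixes P :: "complex \<Rightarrow> complex" and A C :: real
  assumes holomorphic: "P holomorphic_on UNIV"
    and growth: "\<And>t. norm (P (of_real t)) \<le> A + C * \<bar>t\<bar>"
    and deriv_bound: "\<And>t. norm (deriv P (of_real t)) \<le> C"

definition glue :: "(complex \<Rightarrow> complex) \<Rightarrow> (complex \<Rightarrow> complex) \<Rightarrow> complex \<Rightarrow> complex" where
  "glue P Q z = switch z * P z + (1 - switch z) * Q z"

locale two_ends = P: real_linear_growth P A C + Q: real_linear_growth Q A C for P Q A C
begin

lemma glue_holomorphic: "glue P Q holomorphic_on UNIV"
  unfolding glue_def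
  by (intro holomorphic_intros P.holomorphic Q.holomorphic switch_holomorphic)

lemma norm_diff_le: "norm (P (of_real t) - Q (of_real t)) \<le> 2 * A + 2 * C * \<bar>t\<bar>"
  using norm_triangle_ineq4[of "P (of_real t)" "Q (of_real t)"] P.growth[of t] Q.growth[of t] by simp

text \<open>
  The switch takes values in \<open>[0, 1]\<close> on the real line, and so does its derivative
  \<open>exp (- t) exp (- exp (- t))\<close>, because \<open>x \<le> exp x\<close>.
\<close>

lemma glue_deriv_bound: "norm (deriv (glue P Q) (of_real t)) \<le> (2 * A + 2 * C) * (1 + \<bar>t\<bar>)"
proof -
  let ?z = "complex_of_real t"
  let ?s = "exp (- exp (- t))"
  have dP: "(P has_field_derivative deriv P ?z) (at ?z)" "(Q has_field_derivative deriv Q ?z) (at ?z)"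
    using P.holomorphic Q.holomorphic by (auto intro: holomorphic_derivI)
  have "(glue P Q has_field_derivative (exp (- ?z) * switch ?z * (P ?z - Q ?z)
      + switch ?z * deriv P ?z + (1 - switch ?z) * deriv Q ?z)) (at ?z)"
    unfolding glue_def
    by (rule derivative_eq_intros dP switch_has_field_derivative refl)+ (simp add: algebra_simps)
  then have "deriv (glue P Q) ?z = of_real (exp (- t) * ?s) * (P ?z - Q ?z)
      + of_real ?s * deriv P ?z + of_real (1 - ?s) * deriv Q ?z"
    by (simp add: DERIV_imp_deriv switch_of_real exp_of_real[symmetric])
  also have "norm \<dots> \<le> norm (of_real (exp (- t) * ?s) * (P ?z - Q ?z))
      + norm (of_real ?s * deriv P ?z) + norm (of_real (1 - ?s) * deriv Q ?z)"
    by (intro norm_triangle_mono order_refl)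
  also have "norm (of_real (exp (- t) * ?s) * (P ?z - Q ?z)) \<le> 1 * (2 * A + 2 * C * \<bar>t\<bar>)"
  proof -
    have "exp (- t) \<le> exp (exp (- t))"
      by (rule order.trans[OF _ exp_ge_add_one_self]) simp
    then have "exp (- t) * ?s \<le> exp (exp (- t)) * ?s" by (rule mult_right_mono) simp
    then have "exp (- t) * ?s \<le> 1" by (simp flip: exp_add)
    then show ?thesis unfolding norm_mult norm_of_real
      by (intro mult_mono norm_diff_le) auto
  qed
  also have "norm (of_real ?s * deriv P ?z) \<le> 1 * C"
    unfolding norm_mult norm_of_real by (intro mult_mono P.deriv_bound) auto
  also have "norm (of_real (1 - ?s) * deriv Q ?z) \<le> 1 * C"
    unfolding norm_mult norm_of_real by (intro mult_mono Q.deriv_bound) auto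
  finally have "norm (deriv (glue P Q) ?z) \<le> 2 * A + 2 * C * \<bar>t\<bar> + 2 * C" by simp
  moreover have "0 \<le> A" using order.trans[OF norm_ge_zero P.growth[of 0]] by simp
  then have "0 \<le> A * \<bar>t\<bar>" by simp
  ultimately show ?thesis by (simp add: algebra_simps)
qed

lemma glue_asymptotic_at_top: "((\<lambda>t. glue P Q (of_real t) - P (of_real t)) \<longlongrightarrow> 0) at_top"
proof (rule Lim_null_comparison)
  have "((\<lambda>t. 2 * A * exp (- t) + 2 * C * (exp (- t) * \<bar>t\<bar>)) \<longlongrightarrow> 2 * A * 0 + 2 * C * 0) at_top"
    by (intro tendsto_intros; real_asymp)
  then show "((\<lambda>t. 2 * A * exp (- t) + 2 * C * (exp (- t) * \<bar>t\<bar>)) \<longlongrightarrow> 0) at_top" by simp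
  show "\<forall>\<^sub>F t in at_top. norm (glue P Q (of_real t) - P (of_real t))
      \<le> 2 * A * exp (- t) + 2 * C * (exp (- t) * \<bar>t\<bar>)"
  proof (intro always_eventually allI)
    fix t :: real
    let ?s = "exp (- exp (- t))"
    have "glue P Q (of_real t) - P (of_real t) = - (of_real (1 - ?s) * (P (of_real t) - Q (of_real t)))"
      by (simp add: glue_def switch_of_real algebra_simps)
    also have "norm \<dots> = (1 - ?s) * norm (P (of_real t) - Q (of_real t))"
      unfolding norm_minus_cancel norm_mult norm_of_real by simp
    also have "\<dots> \<le> exp (- t) * (2 * A + 2 * C * \<bar>t\<bar>)"
      using exp_ge_add_one_self[of "- exp (- t)"] by (intro mult_mono norm_diff_le) auto
    finally show "norm (glue P Q (of_real t) - P (of_real t))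
        \<le> 2 * A * exp (- t) + 2 * C * (exp (- t) * \<bar>t\<bar>)"
      by (simp add: algebra_simps)
  qed
qed

lemma glue_asymptotic_at_bot: "((\<lambda>t. glue P Q (of_real t) - Q (of_real t)) \<longlongrightarrow> 0) at_bot"
proof (rule Lim_null_comparison)
  let ?s = "\<lambda>t. exp (- exp (- t))"
  have "((\<lambda>t. 2 * A * ?s t + 2 * C * (?s t * \<bar>t\<bar>)) \<longlongrightarrow> 2 * A * 0 + 2 * C * 0) at_bot"
    by (intro tendsto_intros; real_asymp)
  then show "((\<lambda>t. 2 * A * ?s t + 2 * C * (?s t * \<bar>t\<bar>)) \<longlongrightarrow> 0) at_bot" by simp
  show "\<forall>\<^sub>F t in at_bot. norm (glue P Q (of_real t) - Q (of_real t))
      \<le> 2 * A * ?s t + 2 * C * (?s t * \<bar>t\<bar>)"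
  proof (intro always_eventually allI)
    fix t
    have "glue P Q (of_real t) - Q (of_real t) = of_real (?s t) * (P (of_real t) - Q (of_real t))"
      by (simp add: glue_def switch_of_real algebra_simps)
    also have "norm \<dots> = ?s t * norm (P (of_real t) - Q (of_real t))"
      unfolding norm_mult norm_of_real by simp
    also have "\<dots> \<le> ?s t * (2 * A + 2 * C * \<bar>t\<bar>)"
      by (intro mult_left_mono norm_diff_le) auto
    finally show "norm (glue P Q (of_real t) - Q (of_real t))
        \<le> 2 * A * ?s t + 2 * C * (?s t * \<bar>t\<bar>)"
      by (simp add: algebra_simps)
  qed
qed

end

section \<open>Adding small fast loops\<close>

definition phase :: "real \<Rightarrow> real \<Rightarrow> real" where
  "phase l t = l * t * exp (t\<^sup>2)"

text \<open>
  On the real line the modulus is \<open>exp (-t\<^sup>2)\<close> and the argument is the phase. The factor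
  \<open>exp (t\<^sup>2)\<close> in the phase compensates for the shrinking modulus in the speed.
\<close>

definition loop :: "real \<Rightarrow> complex \<Rightarrow> complex" where
  "loop l z = exp (- z\<^sup>2 + \<i> * (of_real l * z * exp (z\<^sup>2)))"

lemma loop_holomorphic: "loop l holomorphic_on UNIV"
  unfolding loop_def by (intro holomorphic_intros)

lemma loop_of_real: "loop l (of_real t) = of_real (exp (- t\<^sup>2)) * cis (phase l t)"
  unfolding loop_def exp_add by (simp add: cis_conv_exp phase_def flip: exp_of_real)

lemma norm_loop_of_real: "norm (loop l (of_real t)) = exp (- t\<^sup>2)"
  by (simp add: loop_of_real norm_mult)

lemma deriv_loop_of_real:
  "deriv (loop l) (of_real t) =
     cis (phase l t) * (\<i> * of_real (l * (1 + 2 * t\<^sup>2)) - of_real (2 * t * exp (- t\<^sup>2)))"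
proof -
  let ?z = "complex_of_real t"
  have "(loop l has_field_derivative
      loop l ?z * (- 2 * ?z + \<i> * (of_real l * (1 + 2 * ?z\<^sup>2) * exp (?z\<^sup>2)))) (at ?z)"
    unfolding loop_def by (auto intro!: derivative_eq_intros simp: algebra_simps power2_eq_square)
  then have "deriv (loop l) ?z = of_real (exp (- t\<^sup>2)) * cis (phase l t)
      * (- 2 * ?z + \<i> * (of_real l * (1 + 2 * ?z\<^sup>2) * of_real (exp (t\<^sup>2))))"
    by (simp add: DERIV_imp_deriv loop_of_real exp_of_real[symmetric])
  also have "\<dots> = cis (phase l t) * (\<i> * of_real (l * (1 + 2 * t\<^sup>2)) * of_real (exp (- t\<^sup>2) * exp (t\<^sup>2))
      - of_real (2 * t * exp (- t\<^sup>2)))"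
    by (simp add: algebra_simps)
  also have "exp (- t\<^sup>2) * exp (t\<^sup>2) = 1" by (simp flip: exp_add)
  finally show ?thesis by simp
qed

locale drift =
  fixes D :: "complex \<Rightarrow> complex" and M :: real
  assumes holomorphic: "D holomorphic_on UNIV"
    and deriv_bound: "\<And>t. norm (deriv D (of_real t)) \<le> M * (1 + \<bar>t\<bar>)"
begin

text \<open>
  The parameter \<open>l = 2 M + 1\<close> of the loops is chosen such that the speed \<open>l (1 + 2 t\<^sup>2)\<close> exceeds the
  bound \<open>M (1 + \<bar>t\<bar>)\<close> for the drift at all times.
\<close>

definition looped :: "complex \<Rightarrow> complex" where
  "looped z = D z + loop (2 * M + 1) z"

lemma M_nonneg: "0 \<le> M"
  using order.trans[OF norm_ge_zero deriv_bound[of 0]] by simp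

lemma looped_holomorphic: "looped holomorphic_on UNIV"
  unfolding looped_def by (intro holomorphic_on_add holomorphic loop_holomorphic)

lemma deriv_looped: "deriv looped z = deriv D z + deriv (loop (2 * M + 1)) z"
  unfolding looped_def
  by (rule deriv_add) (use holomorphic loop_holomorphic in \<open>auto simp: holomorphic_on_def\<close>)

lemma deriv_looped_nonzero: "deriv looped (of_real t) \<noteq> 0"
proof -
  let ?l = "2 * M + 1" and ?u = "1 + 2 * t\<^sup>2"
  have "?l * ?u = \<bar>Im (\<i> * of_real (?l * ?u) - of_real (2 * t * exp (- t\<^sup>2)))\<bar>"
    using M_nonneg by simp
  also have "\<dots> \<le> norm (deriv (loop ?l) (of_real t))"
    unfolding deriv_loop_of_real norm_mult norm_cis mult_1_left by (rule abs_Im_le_cmod)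
  finally have *: "?l * ?u \<le> norm (deriv (loop ?l) (of_real t))" .
  have "0 \<le> (\<bar>t\<bar> - 1)\<^sup>2" by simp
  then have "2 * \<bar>t\<bar> \<le> 1 + t\<^sup>2" by (simp add: power2_eq_square algebra_simps)
  then have "\<bar>t\<bar> \<le> 1 + 2 * (2 * t\<^sup>2)" using zero_le_power2[of t] by linarith
  then have "1 + \<bar>t\<bar> \<le> 2 * ?u" by simp
  then have "M * (1 + \<bar>t\<bar>) \<le> M * (2 * ?u)" by (intro mult_left_mono M_nonneg)
  also have "\<dots> < M * (2 * ?u) + ?u" using zero_le_power2[of t] by linarith
  also have "\<dots> = ?l * ?u" by (simp add: algebra_simps)
  finally have "norm (deriv D (of_real t)) < norm (deriv (loop ?l) (of_real t))"
    using deriv_bound[of t] * by linarith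
  then show ?thesis
    unfolding deriv_looped by (metis add_eq_0_iff norm_minus_cancel less_irrefl)
qed

text \<open>
  Divided by \<open>l (1 + 2 t\<^sup>2) cis (phase t)\<close>, the derivative tends to \<open>\<i>\<close>: the contributions of the
  drift and of the changing modulus to the numerator are only \<open>O(1 + \<bar>t\<bar>)\<close>.
\<close>

lemma looped_tangent_asymptotic:
  "((\<lambda>t. sgn (deriv looped (of_real t)) * cis (- phase (2 * M + 1) t)) \<longlongrightarrow> \<i>) at_infinity"
proof -
  let ?l = "2 * M + 1"
  define u where "u = (\<lambda>t::real. 1 + 2 * t\<^sup>2)"
  have u: "u t > 0" for t unfolding u_def using zero_le_power2[of t] by linarith
  define g where "g = (\<lambda>t. deriv looped (of_real t) * cis (- phase ?l t) / of_real (?l * u t))"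
  have pos: "?l * u t > 0" for t using M_nonneg u by simp
  have nz: "2 * M + 1 \<noteq> 0" "u t \<noteq> 0" for t using M_nonneg u[of t] by auto
  have lim0: "((\<lambda>t. (M + 2) * ((1 + \<bar>t\<bar>) / u t)) \<longlongrightarrow> 0) at_infinity"
  proof -
    have "((\<lambda>t. (1 + \<bar>t\<bar>) / u t) \<longlongrightarrow> 0) at_top" "((\<lambda>t. (1 + \<bar>t\<bar>) / u t) \<longlongrightarrow> 0) at_bot"
      unfolding u_def by real_asymp+
    then have "((\<lambda>t. (1 + \<bar>t\<bar>) / u t) \<longlongrightarrow> 0) at_infinity"
      unfolding at_infinity_eq_at_top_bot by (rule filterlim_sup)
    from tendsto_mult_right_zero[OF this] show ?thesis .
  qed
  have "((\<lambda>t. g t - \<i>) \<longlongrightarrow> 0) at_infinity"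
  proof (rule Lim_null_comparison[OF _ lim0], intro always_eventually allI)
    fix t
    let ?c = "cis (phase ?l t)"
    have "g t - \<i> = (deriv D (of_real t) * cis (- phase ?l t) - of_real (2 * t * exp (- t\<^sup>2))) / of_real (?l * u t)"
    proof -
      have "deriv looped (of_real t) * cis (- phase ?l t) = deriv D (of_real t) * cis (- phase ?l t)
         + (?c * cis (- phase ?l t)) * (\<i> * of_real (?l * u t) - of_real (2 * t * exp (- t\<^sup>2)))"
        by (simp only: deriv_looped deriv_loop_of_real u_def algebra_simps)
      also have "?c * cis (- phase ?l t) = 1" by (simp add: cis_mult)
      finally show ?thesis unfolding g_def using nz(1) nz(2)[of t]
        by (simp add: diff_divide_distrib add_divide_distrib del: of_real_mult of_real_add)
    qed
    also have "norm \<dots> = norm (deriv D (of_real t) * cis (- phase ?l t) - of_real (2 * t * exp (- t\<^sup>2))) / (?l * u t)"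
      using pos[of t] by (simp only: norm_divide norm_of_real abs_of_pos)
    also have "\<dots> \<le> (M + 2) * (1 + \<bar>t\<bar>) / (1 * u t)"
    proof (rule frac_le)
      have "norm (complex_of_real (2 * t * exp (- t\<^sup>2))) = 2 * \<bar>t\<bar> * exp (- t\<^sup>2)"
        unfolding norm_of_real by (simp add: abs_mult)
      also have "\<dots> \<le> 2 * \<bar>t\<bar> * 1" by (intro mult_left_mono) auto
      finally have "norm (complex_of_real (2 * t * exp (- t\<^sup>2))) \<le> 2 * (1 + \<bar>t\<bar>)" by simp
      moreover have "norm (deriv D (of_real t) * cis (- phase ?l t)) \<le> M * (1 + \<bar>t\<bar>)"
        unfolding norm_mult norm_cis using deriv_bound[of t] by simp
      ultimately have "norm (deriv D (of_real t) * cis (- phase ?l t) - of_real (2 * t * exp (- t\<^sup>2)))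
          \<le> M * (1 + \<bar>t\<bar>) + 2 * (1 + \<bar>t\<bar>)"
        by (intro order.trans[OF norm_triangle_ineq4] add_mono)
      then show "norm (deriv D (of_real t) * cis (- phase ?l t) - of_real (2 * t * exp (- t\<^sup>2)))
          \<le> (M + 2) * (1 + \<bar>t\<bar>)" by (simp only: distrib_right)
      show "1 * u t \<le> ?l * u t" using M_nonneg u[of t] by (intro mult_right_mono) auto
    qed (use M_nonneg u in auto)
    finally show "norm (g t - \<i>) \<le> (M + 2) * ((1 + \<bar>t\<bar>) / u t)" by simp
  qed
  then have "(g \<longlongrightarrow> \<i>) at_infinity" by (simp add: LIM_zero_iff)
  then have "((\<lambda>t. sgn (g t)) \<longlongrightarrow> sgn \<i>) at_infinity" by (rule tendsto_sgn) simp
  moreover have "sgn (g t) = sgn (deriv looped (of_real t)) * cis (- phase ?l t)" for t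
  proof -
    have "sgn (g t) = sgn (deriv looped (of_real t)) * sgn (cis (- phase ?l t)) / sgn (of_real (?l * u t))"
      unfolding g_def by (simp only: sgn_mult sgn_divide)
    also have "sgn (complex_of_real (?l * u t)) = 1" using pos[of t] by (simp only: sgn_of_real sgn_pos of_real_1)
    also have "sgn (cis (- phase ?l t)) = cis (- phase ?l t)" by (simp add: sgn_eq)
    finally show ?thesis by simp
  qed
  ultimately show ?thesis by (simp add: sgn_eq)
qed

end

lemma phase_uminus [simp]: "phase l (- t) = - phase l t"
  by (simp add: phase_def)

lemma phase_strict_mono: "l > 0 \<Longrightarrow> 0 \<le> s \<Longrightarrow> s < t \<Longrightarrow> phase l s < phase l t"
  unfolding phase_def by (intro mult_less_le_imp_less mult_strict_left_mono) auto

lemma phase_surj: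
  assumes "l > 0" "c \<ge> 0"
  obtains t where "t \<ge> 0" "phase l t = c"
proof -
  have "l * (c / l) * 1 \<le> l * (c / l) * exp ((c / l)\<^sup>2)" using assms by (intro mult_left_mono) auto
  then have "c \<le> phase l (c / l)" using assms by (simp add: phase_def)
  moreover have "continuous_on {0..c / l} (phase l)" unfolding phase_def by (intro continuous_intros)
  ultimately show thesis
    using IVT'[of "phase l" 0 c "c / l"] assms that by (auto simp: phase_def)
qed

lemma phase_inverse_at_top:
  assumes "l > 0" and c: "filterlim c at_top F" and t: "\<And>n. phase l (t n) = c n"
  shows "filterlim t at_top F"
  unfolding filterlim_at_top
proof
  fix b
  have "\<forall>\<^sub>F n in F. phase l \<bar>b\<bar> < c n" using c by (simp add: filterlim_at_top_dense)
  then show "\<forall>\<^sub>F n in F. b \<le> t n"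
  proof eventually_elim
    case (elim n)
    show ?case
    proof (rule ccontr)
      assume "\<not> b \<le> t n"
      then have "t n < \<bar>b\<bar>" by linarith
      moreover have "0 \<le> phase l \<bar>b\<bar>" using assms(1) by (simp add: phase_def)
      then have "0 < phase l (t n)" using elim t[of n] by linarith
      then have "0 \<le> t n" using assms(1) by (simp add: phase_def zero_less_mult_iff)
      ultimately show False using phase_strict_mono[OF assms(1)] elim t[of n] by fastforce
    qed
  qed
qed

lemma phase_gap:
  assumes "l \<ge> 1" "0 \<le> t" "t < s"
  shows "(s - t) * (1 + 2 * t\<^sup>2) \<le> phase l s - phase l t"
proof -
  have der: "(phase l has_real_derivative l * (1 + 2 * x\<^sup>2) * exp (x\<^sup>2)) (at x)" for x
    unfolding phase_def by (auto intro!: derivative_eq_intros simp: algebra_simps power2_eq_square)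
  obtain x where x: "t < x" "x < s" "phase l s - phase l t = (s - t) * (l * (1 + 2 * x\<^sup>2) * exp (x\<^sup>2))"
    using MVT2[OF assms(3) der] by blast
  have "1 * (1 + 2 * t\<^sup>2) * 1 \<le> l * (1 + 2 * x\<^sup>2) * exp (x\<^sup>2)"
    using assms x by (intro mult_mono add_mono power_mono) auto
  then show ?thesis unfolding x(3) using assms by (intro mult_left_mono) auto
qed

context drift
begin

lemma drift_Lipschitz:
  assumes "\<bar>s\<bar> \<le> R" "\<bar>t\<bar> \<le> R"
  shows "norm (D (of_real s) - D (of_real t)) \<le> M * (1 + R) * \<bar>s - t\<bar>"
proof -
  have seg: "complex_of_real x \<in> closed_segment (of_real (- R)) (of_real R)" if "\<bar>x\<bar> \<le> R" for x
    unfolding closed_segment_of_real using that by (intro imageI) (auto simp: closed_segment_eq_real_ivl)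
  have "norm (D (of_real s) - D (of_real t)) \<le> M * (1 + R) * norm (complex_of_real s - of_real t)"
  proof (rule field_differentiable_bound[of "closed_segment (of_real (- R)) (of_real R)" D "deriv D"])
    fix z :: complex assume "z \<in> closed_segment (of_real (- R)) (of_real R)"
    then obtain x where x: "z = of_real x" "x \<in> closed_segment (- R) R"
      unfolding closed_segment_of_real by blast
    then have "\<bar>x\<bar> \<le> R" using assms by (auto simp: closed_segment_eq_real_ivl split: if_splits)
    have "norm (deriv D z) \<le> M * (1 + \<bar>x\<bar>)" unfolding x(1) by (rule deriv_bound)
    also have "\<dots> \<le> M * (1 + R)" using M_nonneg \<open>\<bar>x\<bar> \<le> R\<close> by (intro mult_left_mono) auto
    finally show "norm (deriv D z) \<le> M * (1 + R)" .
    show "(D has_field_derivative deriv D z) (at z within closed_segment (of_real (- R)) (of_real R))"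
      by (rule holomorphic_derivI[OF holomorphic open_UNIV UNIV_I])
  qed (simp_all only: seg assms convex_closed_segment)
  then show ?thesis unfolding of_real_diff[symmetric] norm_of_real .
qed

lemma looped_minus_drift: "((\<lambda>t. looped (of_real t) - D (of_real t)) \<longlongrightarrow> 0) at_infinity"
proof -
  have "((\<lambda>t::real. exp (- t\<^sup>2)) \<longlongrightarrow> 0) at_top" "((\<lambda>t::real. exp (- t\<^sup>2)) \<longlongrightarrow> 0) at_bot"
    by real_asymp+
  then have "((\<lambda>t::real. exp (- t\<^sup>2)) \<longlongrightarrow> 0) at_infinity"
    unfolding at_infinity_eq_at_top_bot by (rule filterlim_sup)
  then show ?thesis
    by (rule Lim_null_comparison[rotated]) (simp add: looped_def norm_loop_of_real)
qed

text \<open>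
  The phase takes the values \<open>2 \<pi> n\<close> and \<open>2 \<pi> n + \<pi>\<close> at the times \<open>t n\<close> and \<open>s n\<close>, where the loop
  runs in opposite directions. The phase is so fast that \<open>s n - t n \<le> \<pi> / (1 + 2 (t n)\<^sup>2)\<close>, too
  short for the drift to get anywhere. The sign \<open>c\<close> selects the end; as the phase is odd,
  the reflected times serve at \<open>-\<infinity>\<close>.
\<close>

lemma looped_reversing_sequences:
  obtains t s :: "nat \<Rightarrow> real" where "filterlim t at_top sequentially" "filterlim s at_top sequentially"
    "\<And>c. \<bar>c\<bar> = 1 \<Longrightarrow> (\<lambda>n. looped (of_real (c * t n)) - looped (of_real (c * s n))) \<longlonglongrightarrow> 0"
    "\<And>c. \<bar>c\<bar> = 1 \<Longrightarrow> (\<lambda>n. sgn (deriv looped (of_real (c * t n)))) \<longlonglongrightarrow> \<i>"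
    "\<And>c. \<bar>c\<bar> = 1 \<Longrightarrow> (\<lambda>n. sgn (deriv looped (of_real (c * s n)))) \<longlonglongrightarrow> - \<i>"
proof -
  let ?l = "2 * M + 1"
  have l: "?l \<ge> 1" "?l > 0" using M_nonneg by auto
  have "\<exists>t\<ge>0. phase ?l t = 2 * pi * real n" "\<exists>s\<ge>0. phase ?l s = 2 * pi * real n + pi" for n
    using phase_surj[OF l(2)] by (metis add_nonneg_nonneg mult_nonneg_nonneg of_nat_0_le_iff pi_ge_zero zero_le_numeral)+
  then obtain t s where ts: "\<And>n. t n \<ge> 0" "\<And>n. phase ?l (t n) = 2 * pi * real n"
      "\<And>n. s n \<ge> 0" "\<And>n. phase ?l (s n) = 2 * pi * real n + pi"
    by metis
  have "filterlim (\<lambda>n. 2 * pi * real n) at_top sequentially"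
       "filterlim (\<lambda>n. 2 * pi * real n + pi) at_top sequentially" by real_asymp+
  from this[THEN phase_inverse_at_top[OF l(2)]] ts
  have lim: "filterlim t at_top sequentially" "filterlim s at_top sequentially" by auto
  have less: "t n < s n" for n
    using phase_strict_mono[OF l(2), of "s n" "t n"] ts pi_gt_zero
    by (metis less_add_same_cancel1 less_asym linorder_neqE_linordered_idom)
  have gap: "s n - t n \<le> pi / (1 + 2 * (t n)\<^sup>2)" for n
    using phase_gap[OF l(1) ts(1) less, of n] ts zero_le_power2[of "t n"]
    by (subst pos_le_divide_eq) (auto intro: add_pos_nonneg)
  have lim_c: "filterlim (\<lambda>n. c * x n) at_infinity sequentially"
    if "\<bar>c\<bar> = 1" "filterlim x at_top sequentially" for c :: real and x
    by (rule tendsto_mult_filterlim_at_infinity[OF tendsto_const])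
       (use that in \<open>auto intro: filterlim_at_top_imp_at_infinity\<close>)
  have dist0: "(\<lambda>n. looped (of_real (c * t n)) - looped (of_real (c * s n))) \<longlonglongrightarrow> 0" if c: "\<bar>c\<bar> = 1" for c
  proof -
    have "(\<lambda>n. D (of_real (c * t n)) - D (of_real (c * s n))) \<longlonglongrightarrow> 0"
    proof (rule Lim_null_comparison)
      have "((\<lambda>x::real. (1 + (x + pi)) * (pi / (1 + 2 * x\<^sup>2))) \<longlongrightarrow> 0) at_top" by real_asymp
      from tendsto_mult_right_zero[OF filterlim_compose[OF this lim(1)], of M]
      show "(\<lambda>n. M * ((1 + (t n + pi)) * (pi / (1 + 2 * (t n)\<^sup>2)))) \<longlonglongrightarrow> 0" .
      show "\<forall>\<^sub>F n in sequentially. norm (D (of_real (c * t n)) - D (of_real (c * s n)))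
          \<le> M * ((1 + (t n + pi)) * (pi / (1 + 2 * (t n)\<^sup>2)))"
      proof (intro always_eventually allI)
        fix n
        have "pi / (1 + 2 * (t n)\<^sup>2) \<le> pi / 1" by (intro divide_left_mono) (auto intro: add_pos_nonneg)
        then have s: "s n \<le> t n + pi" using gap[of n] by simp
        have "\<bar>c * t n - c * s n\<bar> = \<bar>c\<bar> * \<bar>t n - s n\<bar>" by (simp flip: abs_mult right_diff_distrib)
        then have diff: "\<bar>c * t n - c * s n\<bar> = s n - t n" using c less[of n] by simp
        have "norm (D (of_real (c * t n)) - D (of_real (c * s n))) \<le> M * (1 + (t n + pi)) * \<bar>c * t n - c * s n\<bar>"
          using c ts(1,3)[of n] s by (intro drift_Lipschitz) (auto simp: abs_mult)
        also have "\<dots> \<le> M * (1 + (t n + pi)) * (pi / (1 + 2 * (t n)\<^sup>2))"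
          unfolding diff using gap[of n] M_nonneg ts(1)[of n] by (intro mult_left_mono) auto
        finally show "norm (D (of_real (c * t n)) - D (of_real (c * s n)))
          \<le> M * ((1 + (t n + pi)) * (pi / (1 + 2 * (t n)\<^sup>2)))" by (simp only: mult.assoc)
      qed
    qed
    moreover note filterlim_compose[OF looped_minus_drift lim_c[OF c lim(1)]]
      filterlim_compose[OF looped_minus_drift lim_c[OF c lim(2)]]
    ultimately have "(\<lambda>n. (D (of_real (c * t n)) - D (of_real (c * s n)))
       + (looped (of_real (c * t n)) - D (of_real (c * t n)))
       - (looped (of_real (c * s n)) - D (of_real (c * s n)))) \<longlonglongrightarrow> 0 + 0 - 0"
      by (intro tendsto_add tendsto_diff)
    then show ?thesis by simp
  qed
  have cis: "cis (- phase ?l (c * t n)) = 1" "cis (- phase ?l (c * s n)) = - 1" if "\<bar>c\<bar> = 1" for c n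
  proof -
    have c: "c = 1 \<or> c = - 1" using that by linarith
    have e1: "cis (2 * pi * real n) = 1" by (rule cis_multiple_2pi) simp
    then have e2: "cis (- (2 * pi * real n)) = 1" by (simp flip: cis_inverse)
    have e3: "cis (2 * pi * real n + pi) = - 1" unfolding cis_mult[symmetric] e1 by simp
    then have e4: "cis (- (2 * pi * real n + pi)) = - 1" unfolding cis_inverse[symmetric] by simp
    show "cis (- phase ?l (c * t n)) = 1" "cis (- phase ?l (c * s n)) = - 1"
      using c by (elim disjE;
        simp only: mult_1_left mult_minus1 phase_uminus minus_minus ts(2,4) e1 e2 e3 e4)+
  qed
  show thesis
  proof (rule that[OF lim dist0])
    fix c :: real assume c: "\<bar>c\<bar> = 1"
    show "(\<lambda>n. sgn (deriv looped (of_real (c * t n)))) \<longlonglongrightarrow> \<i>"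
      using filterlim_compose[OF looped_tangent_asymptotic lim_c[OF c lim(1)]] cis(1)[OF c] by simp
    show "(\<lambda>n. sgn (deriv looped (of_real (c * s n)))) \<longlonglongrightarrow> - \<i>"
      using tendsto_minus[OF filterlim_compose[OF looped_tangent_asymptotic lim_c[OF c lim(2)]]] cis(2)[OF c]
      by simp
  qed
qed

end

section \<open>Analytic curves and their extensions\<close>

text \<open>
  A power series in a real variable is a complex power series on the real line, which makes
  the calculus of holomorphic functions available for analytic curves.
\<close>

lemma power_series_near_holomorphic:
  fixes h :: "real \<Rightarrow> complex"
  assumes "power_series_near h t0 r"
  obtains g where "g holomorphic_on ball (of_real t0) r"
    "\<And>t. \<bar>t - t0\<bar> < r \<Longrightarrow> h t = g (of_real t)"
proof -
  obtain c where c: "\<And>t. \<bar>t - t0\<bar> < r \<Longrightarrow> (\<lambda>n. (t - t0) ^ n *\<^sub>R c n) sums h t"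
    using assms unfolding power_series_near_def by blast
  define g where "g = (\<lambda>z. \<Sum>n. c n * (z - of_real t0) ^ n)"
  have "(\<lambda>n. c n * (z - of_real t0) ^ n) sums g z" if "z \<in> ball (of_real t0) r" for z
  proof -
    have "norm (z - of_real t0) < r" using that by (simp add: dist_norm norm_minus_commute)
    then obtain x where x: "norm (z - of_real t0) < x" "x < r" using dense by blast
    then have "0 < x" using norm_ge_zero le_less_trans by blast
    then have "summable (\<lambda>n. x ^ n *\<^sub>R c n)" using c[of "t0 + x"] x(2) by (auto simp: sums_iff)
    then have "summable (\<lambda>n. c n * of_real x ^ n)" by (simp add: scaleR_conv_of_real mult.commute)
    then have "summable (\<lambda>n. c n * (z - of_real t0) ^ n)"
      by (rule powser_inside) (use x \<open>0 < x\<close> in simp)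
    then show ?thesis unfolding g_def by (rule summable_sums)
  qed
  then have "g holomorphic_on ball (of_real t0) r" by (rule power_series_holomorphic)
  moreover have "h t = g (of_real t)" if "\<bar>t - t0\<bar> < r" for t
    using c[OF that] sums_unique unfolding g_def by (simp add: scaleR_conv_of_real mult.commute sums_unique)
  ultimately show thesis by (rule that)
qed

lemma has_vector_derivative_along_reals:
  assumes "g holomorphic_on ball (complex_of_real A) r" "\<bar>s - A\<bar> < r"
  shows "((\<lambda>x. g (of_real x)) has_vector_derivative deriv g (of_real s)) (at s)"
proof (rule has_vector_derivative_real_field, rule holomorphic_derivI[OF assms(1) open_ball])
  show "complex_of_real s \<in> ball (complex_of_real A) r"
    using assms(2) by (simp add: dist_real_def abs_minus_commute dist_of_real)
qed

text \<open>
  On its domain \<open>- {Some 0}\<close> this is the inverse of the parametrisation of the sphere at infinity.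
\<close>

definition infinity_coordinate :: "complex option \<Rightarrow> complex" where
  "infinity_coordinate v = (case v of None \<Rightarrow> 0 | Some z \<Rightarrow> inverse z)"

lemma local_coordinate_the: "local_coordinate (range Some) the"
proof -
  have "at_infinity_param -` range Some = - {0}"
    by (auto simp: at_infinity_param_def split: if_splits)
  moreover have "(the \<circ> at_infinity_param) holomorphic_on - {0}"
    by (rule holomorphic_transform[of inverse])
       (auto simp: at_infinity_param_def intro!: holomorphic_intros)
  moreover have "(the \<circ> Some) holomorphic_on Some -` range Some" by (simp add: o_def)
  moreover have "openin riemann_sphere (range Some)" by simp
  ultimately show ?thesis
    unfolding local_coordinate_def sphere_holomorphic_on_def by (auto intro!: inj_onI)
qed

lemma local_coordinate_infinity: "local_coordinate (- {Some 0}) infinity_coordinate"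
proof -
  have 1: "Some -` (- {Some (0::complex)}) = - {0}" by auto
  have 2: "at_infinity_param -` (- {Some 0}) = UNIV"
    by (auto simp: at_infinity_param_def)
  have "(infinity_coordinate \<circ> Some) = inverse" by (auto simp: infinity_coordinate_def)
  then have 3: "(infinity_coordinate \<circ> Some) holomorphic_on - {0}"
    by (auto intro!: holomorphic_intros)
  have "(infinity_coordinate \<circ> at_infinity_param) = (\<lambda>w. w)"
    by (auto simp: infinity_coordinate_def at_infinity_param_def)
  then have 4: "(infinity_coordinate \<circ> at_infinity_param) holomorphic_on UNIV" by simp
  have "- {Some (0::complex)} = insert None (Some ` (- {0}))"
    by (auto simp: image_iff)
  then have "openin riemann_sphere (- {Some 0})"
    using openin_riemann_sphere_None[of "{0}"] by simp
  then show ?thesis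
    unfolding local_coordinate_def sphere_holomorphic_on_def 1 2 using 3 4
    by (auto intro!: inj_onI simp: infinity_coordinate_def split: option.splits)
qed

text \<open>
  In a local coordinate \<open>z\<close> the curve is the restriction of the holomorphic function \<open>z \<circ> f\<close>,
  and an injective holomorphic function has a derivative without zeros.
\<close>

lemma analytic_curve_of_entire:
  assumes f: "f holomorphic_on UNIV" and nz: "\<And>t. deriv f (of_real t) \<noteq> 0"
  shows "analytic_curve (- \<infinity>) \<infinity> (\<lambda>t. Some (f (of_real t)))"
proof -
  have chart: "open (f -` Some -` U)" "(z \<circ> Some \<circ> f) holomorphic_on f -` Some -` U"
      "(z \<circ> Some) holomorphic_on Some -` U" "inj_on (z \<circ> Some) (Some -` U)" "open (Some -` U)"
    if "local_coordinate U z" for U z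
  proof -
    have U: "openin riemann_sphere U" "(z \<circ> Some) holomorphic_on Some -` U" "inj_on z U"
      using that unfolding local_coordinate_def sphere_holomorphic_on_def by auto
    show op: "open (Some -` U)" using U(1) by (rule open_vimage_Some_riemann_sphere)
    show "open (f -` Some -` U)"
      using f by (intro open_vimage[OF op]) (auto intro: holomorphic_on_imp_continuous_on)
    show "(z \<circ> Some) holomorphic_on Some -` U" by fact
    show "(z \<circ> Some \<circ> f) holomorphic_on f -` Some -` U"
      by (rule holomorphic_on_compose_gen[OF holomorphic_on_subset[OF f] U(2)]) auto
    show "inj_on (z \<circ> Some) (Some -` U)" using U(3) by (auto simp: inj_on_def)
  qed
  have "real_analytic_curve (- \<infinity>) \<infinity> (\<lambda>t. Some (f (of_real t)))"
    unfolding real_analytic_curve_def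
  proof (intro conjI ballI allI impI, simp, elim conjE)
    fix t0 U z
    assume U: "local_coordinate U z" "Some (f (complex_of_real t0)) \<in> U"
    then have "complex_of_real t0 \<in> f -` Some -` U" by simp
    then obtain r where r: "r > 0" "ball (of_real t0) r \<subseteq> f -` Some -` U"
      using chart(1)[OF U(1)] by (meson open_contains_ball)
    have mem: "complex_of_real t \<in> ball (of_real t0) r" if "\<bar>t - t0\<bar> < r" for t
      using that by (simp add: dist_real_def abs_minus_commute dist_of_real)
    let ?h = "z \<circ> Some \<circ> f"
    have hol: "?h holomorphic_on ball (of_real t0) r"
      using chart(2)[OF U(1)] r(2) by (rule holomorphic_on_subset)
    have "power_series_near (z \<circ> (\<lambda>t. Some (f (of_real t)))) t0 r"
      unfolding power_series_near_def
    proof (intro exI allI impI)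
      fix t assume "\<bar>t - t0\<bar> < r"
      from holomorphic_power_series[OF hol mem[OF this]]
      show "(\<lambda>n. (t - t0) ^ n *\<^sub>R ((deriv ^^ n) ?h (of_real t0) / fact n)) sums (z \<circ> (\<lambda>t. Some (f (of_real t)))) t"
        by (simp add: scaleR_conv_of_real mult.commute)
    qed
    moreover have "Some (f (of_real t)) \<in> U" if "\<bar>t - t0\<bar> < r" for t
      using subsetD[OF r(2) mem[OF that]] by simp
    ultimately show "\<exists>r>0. (\<forall>t. \<bar>t - t0\<bar> < r \<longrightarrow> t \<in> einterval (- \<infinity>) \<infinity> \<and> Some (f (of_real t)) \<in> U) \<and>
        power_series_near (z \<circ> (\<lambda>t. Some (f (of_real t)))) t0 r"
      using r(1) by auto
  qed
  moreover have "regular_curve (- \<infinity>) \<infinity> (\<lambda>t. Some (f (of_real t)))"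
    unfolding regular_curve_def
  proof (intro allI impI ballI)
    fix U z t
    assume U: "local_coordinate U z" "Some (f (complex_of_real t)) \<in> U"
    have f': "f (of_real t) \<in> Some -` U" using U(2) by simp
    have dz: "deriv (z \<circ> Some) (f (of_real t)) \<noteq> 0"
      using holomorphic_injective_imp_regular[OF chart(3,5,4)[OF U(1)] f'] .
    have "((z \<circ> Some \<circ> f) has_field_derivative deriv (z \<circ> Some) (f (of_real t)) * deriv f (of_real t)) (at (of_real t))"
      by (rule DERIV_chain[OF holomorphic_derivI[OF chart(3,5)[OF U(1)] f'] holomorphic_derivI[OF f open_UNIV UNIV_I]])
    from has_vector_derivative_real_field[OF this]
    have "vector_derivative (z \<circ> (\<lambda>t. Some (f (of_real t)))) (at t) = deriv (z \<circ> Some) (f (of_real t)) * deriv f (of_real t)"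
      by (simp add: o_def vector_derivative_at)
    then show "vector_derivative (z \<circ> (\<lambda>t. Some (f (of_real t)))) (at t) \<noteq> 0" using dz nz by simp
  qed
  ultimately show ?thesis unfolding analytic_curve_def by blast
qed

lemma analytic_curve_coordinate_expression:
  assumes "analytic_curve L R \<sigma>" "A \<in> einterval L R" "local_coordinate U z" "\<sigma> A \<in> U"
  obtains g r where "r > 0" "g holomorphic_on ball (of_real A) r"
    "\<And>t. \<bar>t - A\<bar> < r \<Longrightarrow> \<sigma> t \<in> U \<and> z (\<sigma> t) = g (of_real t)" "deriv g (of_real A) \<noteq> 0"
proof -
  obtain r where r: "r > 0" "\<And>t. \<bar>t - A\<bar> < r \<Longrightarrow> \<sigma> t \<in> U" "power_series_near (z \<circ> \<sigma>) A r"
    using assms unfolding analytic_curve_def real_analytic_curve_def by meson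
  obtain g where g: "g holomorphic_on ball (of_real A) r" "\<And>t. \<bar>t - A\<bar> < r \<Longrightarrow> (z \<circ> \<sigma>) t = g (of_real t)"
    using power_series_near_holomorphic[OF r(3)] by blast
  have "((\<lambda>x. g (of_real x)) has_vector_derivative deriv g (of_real A)) (at A)"
    using has_vector_derivative_along_reals[OF g(1)] r(1) by simp
  then have "((z \<circ> \<sigma>) has_vector_derivative deriv g (of_real A)) (at A)"
    by (rule has_vector_derivative_transform_within_open[of _ _ _ "ball A r"])
       (use r(1) g(2) in \<open>auto simp: dist_real_def abs_minus_commute\<close>)
  then have "deriv g (of_real A) \<noteq> 0"
    using assms unfolding analytic_curve_def regular_curve_def by (metis vector_derivative_at)
  with r g show thesis by (intro that[of r g]) auto
qed

text \<open>
  Monotonicity excludes negative values of the derivative. The positive sign is what makes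
  tangent directions, and not only tangent lines, invariant under a change of parameter.
\<close>

lemma analytic_param_change_derivative:
  assumes "analytic_param_change c d a b \<phi>" "s \<in> einterval c d"
  obtains \<delta> where "\<delta> > 0" "(\<phi> has_real_derivative \<delta>) (at s)"
proof -
  obtain r where r: "r > 0" "\<And>t. \<bar>t - s\<bar> < r \<Longrightarrow> t \<in> einterval c d" "power_series_near \<phi> s r"
      and nz: "deriv \<phi> s \<noteq> 0" and mono: "strict_mono_on (einterval c d) \<phi>"
    using assms unfolding analytic_param_change_def by meson
  have "power_series_near (\<lambda>t. complex_of_real (\<phi> t)) s r"
  proof -
    obtain k where k: "\<And>t. \<bar>t - s\<bar> < r \<Longrightarrow> (\<lambda>n. (t - s) ^ n *\<^sub>R k n) sums \<phi> t"
      using r(3) unfolding power_series_near_def by blast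
    have "(\<lambda>n. (t - s) ^ n *\<^sub>R complex_of_real (k n)) sums of_real (\<phi> t)" if "\<bar>t - s\<bar> < r" for t
    proof -
      have "(\<lambda>n. (t - s) ^ n *\<^sub>R complex_of_real (k n)) = (\<lambda>n. of_real ((t - s) ^ n *\<^sub>R k n))"
        by (simp add: scaleR_conv_of_real[where 'a = complex])
      then show ?thesis using sums_of_real[OF k[OF that], where 'a = complex] by simp
    qed
    then show ?thesis unfolding power_series_near_def by (intro exI allI impI)
  qed
  then obtain g where g: "g holomorphic_on ball (of_real s) r"
      "\<And>t. \<bar>t - s\<bar> < r \<Longrightarrow> complex_of_real (\<phi> t) = g (of_real t)"
    using power_series_near_holomorphic by blast
  have "((\<lambda>x. g (of_real x)) has_vector_derivative deriv g (of_real s)) (at s)"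
    using has_vector_derivative_along_reals[OF g(1)] r(1) by simp
  then have "((\<lambda>x. complex_of_real (\<phi> x)) has_vector_derivative deriv g (of_real s)) (at s)"
    by (rule has_vector_derivative_transform_within_open[of _ _ _ "ball s r"])
       (use r(1) g(2) in \<open>auto simp: dist_real_def abs_minus_commute\<close>)
  then have D: "(\<phi> has_real_derivative Re (deriv g (of_real s))) (at s)"
    unfolding has_vector_derivative_complex_iff by simp
  define \<delta> where "\<delta> = Re (deriv g (of_real s))"
  have "\<delta> \<noteq> 0" using nz DERIV_imp_deriv[OF D] by (simp add: \<delta>_def)
  moreover have "\<not> \<delta> < 0"
  proof
    assume "\<delta> < 0"
    then obtain e where e: "e > 0" "\<And>h. 0 < h \<Longrightarrow> h < e \<Longrightarrow> \<phi> (s + h) < \<phi> s"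
      using DERIV_neg_dec_right[OF D] unfolding \<delta>_def by blast
    define h where "h = min e r / 2"
    have h: "0 < h" "h < e" "h < r" using e(1) r(1) by (auto simp: h_def)
    have "\<phi> s < \<phi> (s + h)"
      using strict_mono_onD[OF mono, of s "s + h"] h r(2)[of "s + h"] assms(2) by simp
    with e(2)[OF h(1,2)] show False by simp
  qed
  ultimately show thesis using that[of \<delta>] D by (simp add: \<delta>_def)
qed

lemma sgn_deriv_tendsto:
  assumes g: "g holomorphic_on ball (complex_of_real A) r" "r > 0" "deriv g (of_real A) \<noteq> 0"
    and p: "(p \<longlongrightarrow> A) F"
  shows "((\<lambda>n. sgn (deriv g (of_real (p n)))) \<longlongrightarrow> sgn (deriv g (of_real A))) F"
proof -
  have "deriv g holomorphic_on ball (of_real A) r" using holomorphic_deriv[OF g(1)] by simp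
  then have "isCont (deriv g) (of_real A)"
    using holomorphic_on_imp_continuous_on continuous_on_eq_continuous_at[OF open_ball] g(2)
    by (metis centre_in_ball)
  then have "((\<lambda>n. deriv g (of_real (p n))) \<longlongrightarrow> deriv g (of_real A)) F"
    by (rule isCont_tendsto_compose) (intro tendsto_of_real p)
  then show ?thesis using g(3) by (rule tendsto_sgn)
qed

lemma reparametrised_derivative:
  assumes g: "g holomorphic_on ball (complex_of_real A) r" "\<bar>s - A\<bar> < r"
    and f: "f holomorphic_on UNIV" and \<phi>: "(\<phi> has_real_derivative \<delta>) (at s)"
    and h: "(h has_field_derivative h') (at (f (of_real (\<phi> s))))"
    and S: "open S" "s \<in> S" "\<And>x. x \<in> S \<Longrightarrow> \<bar>x - A\<bar> < r \<Longrightarrow> h (f (of_real (\<phi> x))) = g (of_real x)"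
  shows "deriv g (of_real s) = of_real \<delta> * (h' * deriv f (of_real (\<phi> s)))"
proof -
  have "((\<lambda>x. complex_of_real (\<phi> x)) has_vector_derivative of_real \<delta>) (at s)"
    using \<phi> unfolding has_vector_derivative_complex_iff by (auto intro: derivative_eq_intros)
  moreover have "((h \<circ> f) has_field_derivative h' * deriv f (of_real (\<phi> s))) (at (of_real (\<phi> s)))"
    by (rule DERIV_chain[OF h holomorphic_derivI[OF f open_UNIV UNIV_I]])
  ultimately have "((h \<circ> f \<circ> (\<lambda>x. complex_of_real (\<phi> x))) has_vector_derivative
      of_real \<delta> * (h' * deriv f (of_real (\<phi> s)))) (at s)"
    by (rule field_vector_diff_chain_at)
  then have "((\<lambda>x. g (of_real x)) has_vector_derivative of_real \<delta> * (h' * deriv f (of_real (\<phi> s)))) (at s)"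
    by (rule has_vector_derivative_transform_within_open[of _ _ _ "S \<inter> ball A r"])
       (use S g(2) in \<open>auto simp: dist_real_def abs_minus_commute\<close>)
  with has_vector_derivative_along_reals[OF g] show ?thesis
    by (metis vector_derivative_at)
qed

text \<open>
  At an interior parameter \<open>A\<close> the curve \<open>\<sigma>\<close> has a tangent direction that is the limit of the
  nearby ones, in each of the two standard coordinates. If \<open>\<sigma> A\<close> is finite, these are the directions of
  \<open>f'\<close>. If \<open>\<sigma> A = \<infinity>\<close>, they are the directions of \<open>(1 / f)' = - f' / f\<^sup>2\<close>. The values of \<open>f\<close> at the
  two sequences tend to \<open>\<infinity>\<close> while their difference tends to \<open>0\<close>, so that their quotient tends to \<open>1\<close> and the factors \<open>f\<^sup>2\<close> contribute the same direction to both
  sequences in the limit.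
\<close>

lemma tangent_directions_agree:
  fixes p q :: "nat \<Rightarrow> real"
  assumes \<sigma>: "analytic_curve L R \<sigma>" "A \<in> einterval L R"
    and f: "f holomorphic_on UNIV"
    and S: "open S" "\<And>x. x \<in> S \<Longrightarrow> \<sigma> x = Some (f (of_real (\<phi> x)))"
    and \<phi>: "\<And>x. x \<in> S \<Longrightarrow> \<exists>\<delta>>0. (\<phi> has_real_derivative \<delta>) (at x)"
    and p: "\<And>n. p n \<in> S" "p \<longlonglongrightarrow> A" and q: "\<And>n. q n \<in> S" "q \<longlonglongrightarrow> A"
    and close: "(\<lambda>n. f (of_real (\<phi> (p n))) - f (of_real (\<phi> (q n)))) \<longlonglongrightarrow> 0"
    and u: "(\<lambda>n. sgn (deriv f (of_real (\<phi> (p n))))) \<longlonglongrightarrow> u"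
    and v: "(\<lambda>n. sgn (deriv f (of_real (\<phi> (q n))))) \<longlonglongrightarrow> v"
  shows "u = v"
proof (cases "\<sigma> A")
  case (Some w)
  then have "\<sigma> A \<in> range Some" by simp
  from analytic_curve_coordinate_expression[OF \<sigma> local_coordinate_the this]
  obtain g r where g: "r > 0" "g holomorphic_on ball (of_real A) r"
      "\<And>t. \<bar>t - A\<bar> < r \<Longrightarrow> \<sigma> t \<in> range Some \<and> the (\<sigma> t) = g (of_real t)" "deriv g (of_real A) \<noteq> 0"
    by blast
  have dir: "sgn (deriv g (of_real s)) = sgn (deriv f (of_real (\<phi> s)))" if s: "s \<in> S" "\<bar>s - A\<bar> < r" for s
  proof -
    obtain \<delta> where \<delta>: "\<delta> > 0" "(\<phi> has_real_derivative \<delta>) (at s)" using \<phi>[OF s(1)] by blast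
    have "f (of_real (\<phi> x)) = g (of_real x)" if "x \<in> S" "\<bar>x - A\<bar> < r" for x
      using g(3)[OF that(2)] S(2)[OF that(1)] by simp
    then have "deriv g (of_real s) = of_real \<delta> * (1 * deriv f (of_real (\<phi> s)))"
      using reparametrised_derivative[OF g(2) s(2) f \<delta>(2) DERIV_ident S(1) s(1)] by blast
    then show ?thesis using \<delta>(1) by (simp add: sgn_mult sgn_of_real)
  qed
  have lim: "l = sgn (deriv g (of_real A))"
    if x: "\<And>n. x n \<in> S" "x \<longlonglongrightarrow> A" and l: "(\<lambda>n. sgn (deriv f (of_real (\<phi> (x n))))) \<longlonglongrightarrow> l"
    for x :: "nat \<Rightarrow> real" and l
  proof -
    have "\<forall>\<^sub>F n in sequentially. \<bar>x n - A\<bar> < r"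
      using tendstoD[OF x(2) g(1)] by (simp add: dist_real_def)
    then have ev: "\<forall>\<^sub>F n in sequentially. sgn (deriv g (of_real (x n))) = sgn (deriv f (of_real (\<phi> (x n))))"
      by eventually_elim (use dir x(1) in blast)
    have "(\<lambda>n. sgn (deriv f (of_real (\<phi> (x n))))) \<longlonglongrightarrow> sgn (deriv g (of_real A))"
      by (rule Lim_transform_eventually[OF sgn_deriv_tendsto[OF g(2,1,4) x(2)] ev])
    with l show ?thesis by (rule LIMSEQ_unique)
  qed
  from lim[OF p u] lim[OF q v] show ?thesis by simp
next
  case None
  then have "\<sigma> A \<in> - {Some 0}" by simp
  from analytic_curve_coordinate_expression[OF \<sigma> local_coordinate_infinity this]
  obtain g r where g: "r > 0" "g holomorphic_on ball (of_real A) r"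
      "\<And>t. \<bar>t - A\<bar> < r \<Longrightarrow> \<sigma> t \<in> - {Some 0} \<and> infinity_coordinate (\<sigma> t) = g (of_real t)" "deriv g (of_real A) \<noteq> 0"
    by blast
  define k where "k = sgn (deriv g (of_real A))"
  have "k \<noteq> 0" using g(4) by (simp add: k_def sgn_zero_iff)
  define y where "y = (\<lambda>s. f (of_real (\<phi> s)))"
  have y: "y s \<noteq> 0" "inverse (y s) = g (of_real s)" if "s \<in> S" "\<bar>s - A\<bar> < r" for s
    using g(3)[OF that(2)] S(2)[OF that(1)] by (auto simp: y_def infinity_coordinate_def)
  have dir: "sgn (deriv f (of_real (\<phi> s))) = - (sgn (deriv g (of_real s)) * (sgn (y s))\<^sup>2)" if s: "s \<in> S" "\<bar>s - A\<bar> < r" for s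
  proof -
    obtain \<delta> where \<delta>: "\<delta> > 0" "(\<phi> has_real_derivative \<delta>) (at s)" using \<phi>[OF s(1)] by blast
    have "(inverse has_field_derivative - (inverse (y s) ^ Suc (Suc 0))) (at (f (of_real (\<phi> s))))"
      using DERIV_inverse[OF y(1)[OF s]] by (simp add: y_def)
    from reparametrised_derivative[OF g(2) s(2) f \<delta>(2) this S(1) s(1)]
    have "deriv g (of_real s) = of_real \<delta> * (- (inverse (y s) ^ Suc (Suc 0)) * deriv f (of_real (\<phi> s)))"
      using y by (simp add: y_def)
    then have "of_real \<delta> * deriv f (of_real (\<phi> s)) = - (deriv g (of_real s) * (y s)\<^sup>2)"
      using y(1)[OF s] by (simp add: field_simps power2_eq_square)
    then have "sgn (of_real \<delta> * deriv f (of_real (\<phi> s))) = sgn (- (deriv g (of_real s) * (y s)\<^sup>2))" by simp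
    then show ?thesis using \<delta>(1) by (simp add: sgn_mult sgn_of_real sgn_minus power2_eq_square)
  qed
  have near: "\<forall>\<^sub>F n in sequentially. \<bar>x n - A\<bar> < r" if "x \<longlonglongrightarrow> A" for x :: "nat \<Rightarrow> real"
    using tendstoD[OF that g(1)] by (simp add: dist_real_def)
  have "g (of_real A) = 0" using g(3)[of A] g(1) None by (simp add: infinity_coordinate_def)
  moreover have "isCont g (of_real A)"
    using holomorphic_on_imp_continuous_on[OF g(2)] continuous_on_eq_continuous_at[OF open_ball] g(1)
    by (metis centre_in_ball)
  ultimately have "(\<lambda>n. g (of_real (q n))) \<longlonglongrightarrow> 0"
    using isCont_tendsto_compose[of _ g "\<lambda>n. of_real (q n)"] tendsto_of_real[OF q(2)] by metis
  \<comment> \<open>As \<open>g = 1 / y\<close> near \<open>A\<close>, the expression below is the quotient \<open>y (p n) / y (q n)\<close>.\<close>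
  then have "(\<lambda>n. 1 + (y (p n) - y (q n)) * g (of_real (q n))) \<longlonglongrightarrow> 1 + 0 * 0"
    using close unfolding y_def by (intro tendsto_intros)
  then have "(\<lambda>n. sgn (1 + (y (p n) - y (q n)) * g (of_real (q n)))) \<longlonglongrightarrow> sgn 1"
    by (intro tendsto_sgn) simp_all
  then have ratio: "(\<lambda>n. sgn (1 + (y (p n) - y (q n)) * g (of_real (q n)))) \<longlonglongrightarrow> 1" by simp
  have ev: "\<forall>\<^sub>F n in sequentially. sgn (deriv f (of_real (\<phi> (p n)))) * sgn (deriv g (of_real (q n)))
      = sgn (deriv f (of_real (\<phi> (q n)))) * (sgn (deriv g (of_real (p n)))
         * (sgn (1 + (y (p n) - y (q n)) * g (of_real (q n))))\<^sup>2)"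
    using near[OF p(2)] near[OF q(2)]
  proof eventually_elim
    case (elim n)
    have "y (p n) = y (q n) * (1 + (y (p n) - y (q n)) * g (of_real (q n)))"
      using y[OF q(1) elim(2)] by (simp add: field_simps)
    then have "sgn (y (p n)) = sgn (y (q n)) * sgn (1 + (y (p n) - y (q n)) * g (of_real (q n)))"
      by (metis sgn_mult)
    then show ?case
      unfolding dir[OF p(1) elim(1)] dir[OF q(1) elim(2)] by (simp add: power_mult_distrib)
  qed
  have "(\<lambda>n. sgn (deriv f (of_real (\<phi> (p n)))) * sgn (deriv g (of_real (q n)))) \<longlonglongrightarrow> u * k"
    unfolding k_def by (intro tendsto_mult u sgn_deriv_tendsto[OF g(2,1,4) q(2)])
  moreover have "(\<lambda>n. sgn (deriv f (of_real (\<phi> (q n)))) * (sgn (deriv g (of_real (p n)))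
         * (sgn (1 + (y (p n) - y (q n)) * g (of_real (q n))))\<^sup>2)) \<longlonglongrightarrow> v * (k * 1\<^sup>2)"
    unfolding k_def by (intro tendsto_mult tendsto_power ratio v sgn_deriv_tendsto[OF g(2,1,4) p(2)])
  ultimately have "u * k = v * (k * 1\<^sup>2)"
    using Lim_transform_eventually[OF _ ev] LIMSEQ_unique by blast
  with \<open>k \<noteq> 0\<close> show ?thesis by simp
qed

text \<open>
  The parameters of an extension that correspond to \<open>t n\<close> and \<open>s n\<close> tend to its interior
  parameter \<open>A\<close>.
\<close>

lemma no_terminal_extension:
  fixes t s :: "nat \<Rightarrow> real"
  assumes f: "f holomorphic_on UNIV"
    and t: "filterlim t at_top sequentially" and s: "filterlim s at_top sequentially"
    and close: "(\<lambda>n. f (of_real (t n)) - f (of_real (s n))) \<longlonglongrightarrow> 0"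
    and u: "(\<lambda>n. sgn (deriv f (of_real (t n)))) \<longlonglongrightarrow> u"
    and v: "(\<lambda>n. sgn (deriv f (of_real (s n)))) \<longlonglongrightarrow> v" and "u \<noteq> v"
  shows "\<not> has_terminal_extension (- \<infinity>) \<infinity> (\<lambda>t. Some (f (of_real t)))"
proof
  assume "has_terminal_extension (- \<infinity>) \<infinity> (\<lambda>t. Some (f (of_real t)))"
  then obtain L R \<sigma> A \<phi> where \<sigma>: "analytic_curve L R \<sigma>" "A \<in> einterval L R"
    and pc: "analytic_param_change L (ereal A) (- \<infinity>) \<infinity> \<phi>"
    and eq: "\<And>x. x \<in> einterval L (ereal A) \<Longrightarrow> \<sigma> x = Some (f (of_real (\<phi> x)))"
    unfolding has_terminal_extension_def by blast
  define S where "S = einterval L (ereal A)"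
  have bij: "bij_betw \<phi> S UNIV" and mono: "strict_mono_on S \<phi>"
    using pc unfolding analytic_param_change_def S_def by auto
  define p where "p = inv_into S \<phi>"
  have p: "p x \<in> S" "\<phi> (p x) = x" for x
    using bij unfolding p_def bij_betw_def by (auto simp: f_inv_into_f inv_into_into)
  have lim: "(\<lambda>n. p (x n)) \<longlonglongrightarrow> A" if x: "filterlim x at_top sequentially" for x :: "nat \<Rightarrow> real"
  proof (rule order_tendstoI)
    fix a assume "a < A"
    then have "max (ereal a) L < ereal A" using \<sigma>(2) by (simp add: einterval_iff)
    then obtain b where b: "max (ereal a) L < ereal b" "ereal b < ereal A" using ereal_dense2 by blast
    then have bS: "b \<in> S" and "a < b" by (auto simp: S_def einterval_iff)
    have "\<forall>\<^sub>F n in sequentially. \<phi> b < x n" using x by (simp add: filterlim_at_top_dense)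
    then show "\<forall>\<^sub>F n in sequentially. a < p (x n)"
    proof eventually_elim
      case (elim n)
      then have "\<phi> b < \<phi> (p (x n))" by (simp add: p)
      then have "b < p (x n)" using strict_mono_on_less[OF mono bS p(1)] by simp
      with \<open>a < b\<close> show ?case by simp
    qed
  next
    fix a assume "A < a"
    moreover have "p y < A" for y using p(1)[of y] by (simp add: S_def einterval_iff)
    ultimately show "\<forall>\<^sub>F n in sequentially. p (x n) < a"
      by (intro always_eventually allI) (rule less_trans)
  qed
  have "\<exists>\<delta>>0. (\<phi> has_real_derivative \<delta>) (at x)" if "x \<in> S" for x
    using analytic_param_change_derivative[OF pc] that unfolding S_def by blast
  then have "u = v"
    by (intro tangent_directions_agree[OF \<sigma> f, of S \<phi> "\<lambda>n. p (t n)" "\<lambda>n. p (s n)"])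
       (use p eq close u v lim[OF t] lim[OF s] in \<open>simp_all add: S_def\<close>)
  with \<open>u \<noteq> v\<close> show False by simp
qed

lemma no_initial_extension:
  fixes t s :: "nat \<Rightarrow> real"
  assumes f: "f holomorphic_on UNIV"
    and t: "filterlim t at_bot sequentially" and s: "filterlim s at_bot sequentially"
    and close: "(\<lambda>n. f (of_real (t n)) - f (of_real (s n))) \<longlonglongrightarrow> 0"
    and u: "(\<lambda>n. sgn (deriv f (of_real (t n)))) \<longlonglongrightarrow> u"
    and v: "(\<lambda>n. sgn (deriv f (of_real (s n)))) \<longlonglongrightarrow> v" and "u \<noteq> v"
  shows "\<not> has_initial_extension (- \<infinity>) \<infinity> (\<lambda>t. Some (f (of_real t)))"
proof
  assume "has_initial_extension (- \<infinity>) \<infinity> (\<lambda>t. Some (f (of_real t)))"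
  then obtain L R \<sigma> A \<phi> where \<sigma>: "analytic_curve L R \<sigma>" "A \<in> einterval L R"
    and pc: "analytic_param_change (ereal A) R (- \<infinity>) \<infinity> \<phi>"
    and eq: "\<And>x. x \<in> einterval (ereal A) R \<Longrightarrow> \<sigma> x = Some (f (of_real (\<phi> x)))"
    unfolding has_initial_extension_def by blast
  define S where "S = einterval (ereal A) R"
  have bij: "bij_betw \<phi> S UNIV" and mono: "strict_mono_on S \<phi>"
    using pc unfolding analytic_param_change_def S_def by auto
  define p where "p = inv_into S \<phi>"
  have p: "p x \<in> S" "\<phi> (p x) = x" for x
    using bij unfolding p_def bij_betw_def by (auto simp: f_inv_into_f inv_into_into)
  have lim: "(\<lambda>n. p (x n)) \<longlonglongrightarrow> A" if x: "filterlim x at_bot sequentially" for x :: "nat \<Rightarrow> real"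
  proof (rule order_tendstoI)
    fix a assume "A < a"
    then have "ereal A < min (ereal a) R" using \<sigma>(2) by (simp add: einterval_iff)
    then obtain b where b: "ereal A < ereal b" "ereal b < min (ereal a) R" using ereal_dense2 by blast
    then have bS: "b \<in> S" and "b < a" by (auto simp: S_def einterval_iff)
    have "\<forall>\<^sub>F n in sequentially. x n < \<phi> b" using x by (simp add: filterlim_at_bot_dense)
    then show "\<forall>\<^sub>F n in sequentially. p (x n) < a"
    proof eventually_elim
      case (elim n)
      then have "\<phi> (p (x n)) < \<phi> b" by (simp add: p)
      then have "p (x n) < b" using strict_mono_on_less[OF mono p(1) bS] by simp
      with \<open>b < a\<close> show ?case by simp
    qed
  next
    fix a assume "a < A"
    moreover have "A < p y" for y using p(1)[of y] by (simp add: S_def einterval_iff)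
    ultimately show "\<forall>\<^sub>F n in sequentially. a < p (x n)"
      by (intro always_eventually allI) (rule less_trans)
  qed
  have "\<exists>\<delta>>0. (\<phi> has_real_derivative \<delta>) (at x)" if "x \<in> S" for x
    using analytic_param_change_derivative[OF pc] that unfolding S_def by blast
  then have "u = v"
    by (intro tangent_directions_agree[OF \<sigma> f, of S \<phi> "\<lambda>n. p (t n)" "\<lambda>n. p (s n)"])
       (use p eq close u v lim[OF t] lim[OF s] in \<open>simp_all add: S_def\<close>)
  with \<open>u \<noteq> v\<close> show False by simp
qed

text \<open>
  The curve inherits the limit points of the sequence because every index is attained:
  \<open>x n\<close> is a time at which the curve is close to \<open>w n\<close>.
\<close>

lemma cluster_set_of_asymptotic_sequence:
  assumes asym: "((\<lambda>t. f (of_real t) - w (m t)) \<longlongrightarrow> 0) F" and m: "filterlim m at_top F"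
    and x: "filterlim x F sequentially" "\<And>n. m (x n) = n"
    and F: "\<And>t :: nat \<Rightarrow> real. (\<lambda>n. ereal (t n)) \<longlonglongrightarrow> e \<longleftrightarrow> filterlim t F sequentially"
  shows "cluster_set (- \<infinity>) \<infinity> (\<lambda>t. Some (f (complex_of_real t))) e =
    {v. \<exists>\<rho>. filterlim \<rho> at_top sequentially \<and>
       limitin riemann_sphere (\<lambda>n. Some (w (\<rho> n))) v sequentially}"
proof (intro equalityI subsetI)
  fix v assume "v \<in> cluster_set (- \<infinity>) \<infinity> (\<lambda>t. Some (f (complex_of_real t))) e"
  then obtain t where t: "filterlim t F sequentially"
      "limitin riemann_sphere (\<lambda>n. Some (f (complex_of_real (t n)))) v sequentially"
    unfolding cluster_set_def F by blast
  have "(\<lambda>n. w (m (t n)) - f (of_real (t n))) \<longlonglongrightarrow> 0"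
    using tendsto_minus[OF filterlim_compose[OF asym t(1)]] by simp
  from limitin_riemann_sphere_perturb[OF this t(2)] filterlim_compose[OF m t(1)]
  show "v \<in> {v. \<exists>\<rho>. filterlim \<rho> at_top sequentially \<and>
       limitin riemann_sphere (\<lambda>n. Some (w (\<rho> n))) v sequentially}" by blast
next
  fix v assume "v \<in> {v. \<exists>\<rho>. filterlim \<rho> at_top sequentially \<and>
       limitin riemann_sphere (\<lambda>n. Some (w (\<rho> n))) v sequentially}"
  then obtain \<rho> where \<rho>: "filterlim \<rho> at_top sequentially"
      "limitin riemann_sphere (\<lambda>n. Some (w (\<rho> n))) v sequentially" by blast
  have xF: "filterlim (\<lambda>n. x (\<rho> n)) F sequentially" by (rule filterlim_compose[OF x(1) \<rho>(1)])
  have "(\<lambda>n. f (of_real (x (\<rho> n))) - w (\<rho> n)) \<longlonglongrightarrow> 0"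
    using filterlim_compose[OF asym xF] by (simp add: x(2))
  from limitin_riemann_sphere_perturb[OF this \<rho>(2)] xF
  show "v \<in> cluster_set (- \<infinity>) \<infinity> (\<lambda>t. Some (f (complex_of_real t))) e"
    unfolding cluster_set_def F einterval_eq by blast
qed

section \<open>Curves with prescribed cluster sets\<close>

lemma log_interpolant_real_linear_growth:
  assumes "\<And>n. norm (w (Suc n) - w n) \<le> B" "norm (w 0) \<le> A"
  shows "real_linear_growth (log_interpolant w) A (2 * B)"
proof
  show hol: "log_interpolant w holomorphic_on UNIV"
    using assms(1) by (rule log_interpolant_holomorphic)
  fix t
  show "norm (log_interpolant w (of_real t)) \<le> A + 2 * B * \<bar>t\<bar>"
    using log_interpolant_linear_growth[of w B t] assms by (auto intro: order.trans)
  show "norm (deriv (log_interpolant w) (of_real t)) \<le> 2 * B"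
  proof (rule norm_deriv_le_of_real_Lipschitz)
    show "log_interpolant w field_differentiable at (of_real t)"
      using hol by (simp add: holomorphic_on_def)
  qed (use log_interpolant_Lipschitz[of w B] assms(1) in blast)
qed

theorem theorem2p1:
  fixes Kminus Kplus :: "complex option set"
  assumes "continuum_in riemann_sphere Kminus"
    and "continuum_in riemann_sphere Kplus"
  shows "\<exists>(f :: complex \<Rightarrow> complex) (\<gamma> :: real \<Rightarrow> complex option).
           f holomorphic_on UNIV \<and>
           (\<forall>t. \<gamma> t = Some (f (complex_of_real t))) \<and>
           analytic_curve (-\<infinity>) \<infinity> \<gamma> \<and>
           cluster_set (-\<infinity>) \<infinity> \<gamma> (-\<infinity>) = Kminus \<and>
           cluster_set (-\<infinity>) \<infinity> \<gamma> \<infinity> = Kplus \<and>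
           maximal_analytic_curve (-\<infinity>) \<infinity> \<gamma>"
proof -
  obtain wp where wp: "(\<lambda>n. wp (Suc n) - wp n) \<longlonglongrightarrow> 0"
    and Kp: "\<And>v. v \<in> Kplus \<longleftrightarrow> (\<exists>\<rho>. filterlim \<rho> at_top sequentially \<and>
       limitin riemann_sphere (\<lambda>n. Some (wp (\<rho> n))) v sequentially)"
    using continuum_is_cluster_set_of_slow_sequence[OF assms(2)] by blast
  obtain wm where wm: "(\<lambda>n. wm (Suc n) - wm n) \<longlonglongrightarrow> 0"
    and Km: "\<And>v. v \<in> Kminus \<longleftrightarrow> (\<exists>\<rho>. filterlim \<rho> at_top sequentially \<and>
       limitin riemann_sphere (\<lambda>n. Some (wm (\<rho> n))) v sequentially)"
    using continuum_is_cluster_set_of_slow_sequence[OF assms(1)] by blast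
  obtain Bp Bm where "\<And>n. norm (wp (Suc n) - wp n) \<le> Bp" "\<And>n. norm (wm (Suc n) - wm n) \<le> Bm"
    using convergent_imp_Bseq[OF convergentI[OF wp]] convergent_imp_Bseq[OF convergentI[OF wm]]
    unfolding Bseq_def by blast
  then obtain B where Bp: "\<And>n. norm (wp (Suc n) - wp n) \<le> B" and Bm: "\<And>n. norm (wm (Suc n) - wm n) \<le> B"
    by (meson max.coboundedI1 max.coboundedI2)
  define A where "A = max (norm (wp 0)) (norm (wm 0))"
  define P where "P = log_interpolant wp"
  define Q where "Q = log_interpolant wm"
  interpret P: real_linear_growth P A "2 * B"
    unfolding P_def by (rule log_interpolant_real_linear_growth) (simp_all add: A_def Bp)
  interpret Q: real_linear_growth Q A "2 * B"
    unfolding Q_def by (rule log_interpolant_real_linear_growth) (simp_all add: A_def Bm)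
  interpret PQ: two_ends P Q A "2 * B" ..
  interpret D: drift "glue P Q" "2 * A + 2 * (2 * B)"
    by standard (rule PQ.glue_holomorphic PQ.glue_deriv_bound)+
  define f where "f = D.looped"
  define \<gamma> where "\<gamma> = (\<lambda>t. Some (f (complex_of_real t)))"
  have hol: "f holomorphic_on UNIV" unfolding f_def by (rule D.looped_holomorphic)
  have curve: "analytic_curve (- \<infinity>) \<infinity> \<gamma>"
    unfolding \<gamma>_def using analytic_curve_of_entire[OF hol] D.deriv_looped_nonzero by (simp add: f_def)
  have at_top: "((\<lambda>t. f (of_real t) - wp (log_index t)) \<longlongrightarrow> 0) at_top"
  proof -
    have "((\<lambda>t. f (of_real t) - glue P Q (of_real t)) \<longlongrightarrow> 0) at_top"
      using D.looped_minus_drift unfolding f_def by (rule filterlim_mono) (auto simp: at_infinity_eq_at_top_bot)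
    from tendsto_add[OF tendsto_add[OF this PQ.glue_asymptotic_at_top] log_interpolant_asymptotic[of wp B, OF Bp wp]]
    show ?thesis by (simp add: P_def)
  qed
  have at_bot: "((\<lambda>t. f (of_real t) - wm (log_index t)) \<longlongrightarrow> 0) at_bot"
  proof -
    have "((\<lambda>t. f (of_real t) - glue P Q (of_real t)) \<longlongrightarrow> 0) at_bot"
      using D.looped_minus_drift unfolding f_def by (rule filterlim_mono) (auto simp: at_infinity_eq_at_top_bot)
    moreover have "((\<lambda>t. Q (of_real t) - wm (log_index t)) \<longlongrightarrow> 0) at_bot"
      unfolding Q_def filterlim_at_bot_mirror using log_interpolant_asymptotic[of wm B, OF Bm wm] by simp
    ultimately have "((\<lambda>t. (f (of_real t) - glue P Q (of_real t)) + (glue P Q (of_real t) - Q (of_real t))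
        + (Q (of_real t) - wm (log_index t))) \<longlongrightarrow> 0 + 0 + 0) at_bot"
      by (intro tendsto_add PQ.glue_asymptotic_at_bot)
    then show ?thesis by simp
  qed
  have exp2: "filterlim (\<lambda>n. 2 ^ n :: real) at_top sequentially" by real_asymp
  have "cluster_set (- \<infinity>) \<infinity> \<gamma> \<infinity> = Kplus"
    unfolding \<gamma>_def
    by (subst cluster_set_of_asymptotic_sequence[OF at_top log_index_at_top exp2 log_index_power2 tendsto_PInfty_eq_at_top])
       (use Kp in blast)
  moreover have "cluster_set (- \<infinity>) \<infinity> \<gamma> (- \<infinity>) = Kminus"
  proof -
    have m: "filterlim log_index at_top at_bot"
      unfolding filterlim_at_bot_mirror using log_index_at_top by simp
    have x: "filterlim (\<lambda>n. - (2 ^ n) :: real) at_bot sequentially" by real_asymp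
    have F: "(\<lambda>n. ereal (t n)) \<longlonglongrightarrow> - \<infinity> \<longleftrightarrow> filterlim t at_bot sequentially" for t
      using ereal_tendsto_simps2(3)[of t sequentially] by (simp add: o_def)
    show ?thesis
      unfolding \<gamma>_def
      by (subst cluster_set_of_asymptotic_sequence[OF at_bot m x _ F]) (use Km in auto)
  qed
  moreover have "maximal_analytic_curve (- \<infinity>) \<infinity> \<gamma>"
  proof -
    obtain t s :: "nat \<Rightarrow> real" where lim: "filterlim t at_top sequentially" "filterlim s at_top sequentially"
      and close: "\<And>c. \<bar>c\<bar> = 1 \<Longrightarrow> (\<lambda>n. f (of_real (c * t n)) - f (of_real (c * s n))) \<longlonglongrightarrow> 0"
      and dir: "\<And>c. \<bar>c\<bar> = 1 \<Longrightarrow> (\<lambda>n. sgn (deriv f (of_real (c * t n)))) \<longlonglongrightarrow> \<i>"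
        "\<And>c. \<bar>c\<bar> = 1 \<Longrightarrow> (\<lambda>n. sgn (deriv f (of_real (c * s n)))) \<longlonglongrightarrow> - \<i>"
      using D.looped_reversing_sequences unfolding f_def by blast
    have "\<i> \<noteq> - \<i>" by (simp add: complex_eq_iff)
    have "\<not> has_terminal_extension (- \<infinity>) \<infinity> \<gamma>"
      unfolding \<gamma>_def using close[of 1] dir[of 1]
      by (intro no_terminal_extension[OF hol lim _ _ _ \<open>\<i> \<noteq> - \<i>\<close>]) simp_all
    moreover have "\<not> has_initial_extension (- \<infinity>) \<infinity> \<gamma>"
      unfolding \<gamma>_def using close[of "- 1"] dir[of "- 1"] lim
      by (intro no_initial_extension[OF hol _ _ _ _ _ \<open>\<i> \<noteq> - \<i>\<close>, of "\<lambda>n. - t n" "\<lambda>n. - s n"])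
         (simp_all flip: filterlim_uminus_at_top)
    ultimately show ?thesis using curve unfolding maximal_analytic_curve_def by blast
  qed
  ultimately show ?thesis
    using hol curve by (intro exI[of _ f] exI[of _ \<gamma>]) (simp add: \<gamma>_def)
qed

end
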